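(* Assume $\mathbb{E}(|\nu_v|^{2+\varepsilon}+|\omega_e|^{2+\varepsilon})<\infty$ for some $\varepsilon>0$. Let $\langle U\rangle_n$ denote the Gibbs average of the number $U$ of unpaired vertices of a matching of $\mathcal{G}_n$. Let $\sigma_A^2=\lim_{n\to\infty}n^{-1}\operatorname{Var}(\langle U\rangle_n)$ (this limit exists in $[0,\infty)$). Then, as $n\to\infty$, $$n^{-1/2}\,(\langle U\rangle_n-\mathbb{E}\langle U\rangle_n)\to N(0,\sigma_A^2)\quad\text{in distribution}.$$
   Context: Let $H=(V_H,E_H)$ be a fixed finite graph with $|V_H|=h\ge 1$, and let $G_n$ be the line graph (path) on the $n$ vertices $1,\dots,n$ with $i\sim i+1$. The cylinder graph $\mathcal{G}_n=G_n\times H$ is the Cartesian product: its vertex set is $V=\{1,\dots,n\}\times V_H$, and $(i,j)\sim(i',j')$ iff either $i\sim i'$ in $G_n$ and $j=j'$, or $i=i'$ and $j\sim j'$ in $H$. Let $E$ be its edge set. The vertex weights $\{\nu_v\}_{v\in V}$ are i.i.d. real random variables; the edge weights $\{\omega_e\}_{e\in E}$ are i.i.d. real random variables, independent of the vertex weights, possibly with a different law; the two laws do not depend on $n$. A matching $\mathfrak{m}\subseteq E$ is a (possibly empty) set of pairwise vertex-disjoint edges; $\mathcal{M}$ is the set of all matchings of $\mathcal{G}_n$; $v\notin\mathfrak{m}$ ($v$ is unpaired) means that $v$ is not covered by any edge of $\mathfrak{m}$. The Hamiltonian is $\mathcal{H}(\mathfrak{m})=\sum_{v\notin\mathfrak{m}}\nu_v+\sum_{e\in\mathfrak{m}}\omega_e$,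 the partition function is $Z_n=\sum_{\mathfrak{m}\in\mathcal{M}}\exp(\mathcal{H}(\mathfrak{m}))$, and the (random) Gibbs measure is $\mu(\mathfrak{m})=Z_n^{-1}\exp(\mathcal{H}(\mathfrak{m}))$. For $X:\mathcal{M}\to\mathbb{R}$, $\langle X\rangle_n=\sum_{\mathfrak{m}\in\mathcal{M}}X(\mathfrak{m})\mu(\mathfrak{m})$ is its Gibbs average, a random variable depending on the weights. $N(0,0)$ is the Dirac mass at $0$. *)

theory Defs
  imports "HOL-Probability.Probability"
begin

text \<open>Graphs are finite, simple and undirected; an edge is its two-element set of endpoints.\<close>

locale finite_graph =
  fixes V :: "'v set" and E :: "'v set set"
  assumes finite_verts: "finite V"
    and edges: "\<And>e. e \<in> E \<Longrightarrow> e \<subseteq> V \<and> card e = 2"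

definition path_verts :: "nat \<Rightarrow> nat set" where
  "path_verts n = {1..n}"

definition path_edges :: "nat \<Rightarrow> nat set set" where
  "path_edges n = {{i, i + 1} | i. 1 \<le> i \<and> i + 1 \<le> n}"

definition cart_edges ::
  "'v set \<Rightarrow> 'v set set \<Rightarrow> 'w set \<Rightarrow> 'w set set \<Rightarrow> ('v \<times> 'w) set set" where
  "cart_edges V1 E1 V2 E2 =
     {{(i, j), (i', j')} | i j i' j'.
        i \<in> V1 \<and> i' \<in> V1 \<and> j \<in> V2 \<and> j' \<in> V2 \<and>
        ({i, i'} \<in> E1 \<and> j = j' \<or> i = i' \<and> {j, j'} \<in> E2)}"

definition cyl_verts :: "'h set \<Rightarrow> nat \<Rightarrow> (nat \<times> 'h) set" where
  "cyl_verts VH n = path_verts n \<times> VH"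

definition cyl_edges :: "'h set \<Rightarrow> 'h set set \<Rightarrow> nat \<Rightarrow> (nat \<times> 'h) set set" where
  "cyl_edges VH EH n = cart_edges (path_verts n) (path_edges n) VH EH"

definition matchings :: "'v set set \<Rightarrow> 'v set set set" where
  "matchings E = {m. m \<subseteq> E \<and> disjoint m}"

definition unpaired :: "'v set \<Rightarrow> 'v set set \<Rightarrow> 'v set" where
  "unpaired V m = {v \<in> V. \<forall>e\<in>m. v \<notin> e}"

definition hamiltonian ::
  "'v set \<Rightarrow> ('v \<Rightarrow> real) \<Rightarrow> ('v set \<Rightarrow> real) \<Rightarrow> 'v set set \<Rightarrow> real" where
  "hamiltonian V \<nu> \<omega> m = (\<Sum>v\<in>unpaired V m. \<nu> v) + (\<Sum>e\<in>m. \<omega> e)"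

definition partition_function ::
  "'v set \<Rightarrow> 'v set set \<Rightarrow> ('v \<Rightarrow> real) \<Rightarrow> ('v set \<Rightarrow> real) \<Rightarrow> real" where
  "partition_function V E \<nu> \<omega> = (\<Sum>m\<in>matchings E. exp (hamiltonian V \<nu> \<omega> m))"

definition gibbs ::
  "'v set \<Rightarrow> 'v set set \<Rightarrow> ('v \<Rightarrow> real) \<Rightarrow> ('v set \<Rightarrow> real) \<Rightarrow> 'v set set \<Rightarrow> real" where
  "gibbs V E \<nu> \<omega> m = exp (hamiltonian V \<nu> \<omega> m) / partition_function V E \<nu> \<omega>"

definition gibbs_average ::
  "'v set \<Rightarrow> 'v set set \<Rightarrow> ('v \<Rightarrow> real) \<Rightarrow> ('v set \<Rightarrow> real) \<Rightarrow> ('v set set \<Rightarrow> real) \<Rightarrow> real" where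
  "gibbs_average V E \<nu> \<omega> X = (\<Sum>m\<in>matchings E. X m * gibbs V E \<nu> \<omega> m)"

definition avg_unpaired ::
  "'h set \<Rightarrow> 'h set set \<Rightarrow> nat \<Rightarrow> (nat \<times> 'h \<Rightarrow> real) \<Rightarrow> ((nat \<times> 'h) set \<Rightarrow> real) \<Rightarrow> real" where
  "avg_unpaired VH EH n \<nu> \<omega> =
     gibbs_average (cyl_verts VH n) (cyl_edges VH EH n) \<nu> \<omega>
       (\<lambda>m. real (card (unpaired (cyl_verts VH n) m)))"

text \<open>The second parameter of \<^const>\<open>normal_density\<close> is the standard deviation, and at
  standard deviation 0 it is not the density of a probability measure.\<close>

definition centered_normal :: "real \<Rightarrow> real measure" where
  "centered_normal s2 =
     (if s2 = 0 then return borel 0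
      else density lborel (\<lambda>x. ennreal (normal_density 0 (sqrt s2) x)))"

end

theory Submission
  imports Defs
begin

text \<open>The Gibbs measure gives a matching \<open>m\<close> a weight proportional to \<open>\<Prod>e\<in>m. x e\<close> with
  \<open>x e = exp (\<omega> e - (\<Sum>v\<in>e. \<nu> v))\<close>. Compare independent matchings of two graphs that agree on
  one side of some cuts. If neither matching crosses one of these cuts, their parts on that side can
  be exchanged, so the two probabilities that a vertex \<open>v\<close> on that side is unpaired differ by at most
  the probability that every cut is crossed. A cut \<open>s\<close> is uncrossed by a matching with conditional
  probability at least \<open>\<kappa> s = (\<Prod>e. 1 / (1 + x e))\<close>, the product being over the edges across the
  cut; so the difference is at most \<open>\<Prod>s. 1 - (\<kappa> s)\<^sup>2\<close>. On the cylinder, these factors are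
  independent and identically distributed for cuts at distance 2 from each other, and their mean is
  less than 1. Hence, writing \<open>F a b\<close> for the Gibbs average of the number of unpaired vertices on the
  layers \<open>a + 1, \<dots>, b\<close>, the fourth moment of \<open>F a c - F a b - F b c\<close> is bounded uniformly, whereas
  \<open>F a b\<close> and \<open>F b c\<close> are independent. Together with stationarity this gives convergence of
  the variances per layer along powers of 2 and fourth moments of quadratic order; Lyapunov's
  argument for about \<open>n powr (1/3)\<close> blocks of length about \<open>n powr (2/3)\<close> then yields the limit.\<close>

section \<open>Comparison of monomer-dimer measures on two graphs\<close>

text \<open>Activities may be arbitrarily large, so no bound uniform in the weights says that a cut
  is uncrossed with substantial probability. Influence decays only in the mean over the weights, and
  the defect of additivity is therefore controlled by moments. \<open>\<kappa> s\<close> comes from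
  deleting all edges across the cut: the deleted sets have total weight at most
  \<open>\<Prod>e. 1 + x e\<close>. Its square appears because neither of two independent matchings
  may cross. Distance 2 between cuts is forced because the activity of an edge across the cut
  \<open>s\<close> contains the vertex weights of both layers \<open>s\<close> and
  \<open>s + 1\<close>. In the limit theorem each division into blocks costs an error of order 1 in
  L2, and these errors add up; so blocks must be long and few. Moments of long blocks are obtained
  by doubling, which controls them only along powers of 2. Hence blocks of dyadic length, and a
  cruder bound for the remainder. Fourth moments serve because that of a sum of two independent
  centred variables has an exact formula, and because they bound the third-order error of the
  characteristic function.\<close>

definition unpaired_prob :: "('v set \<Rightarrow> real) \<Rightarrow> 'v set set \<Rightarrow> 'v \<Rightarrow> real" where
  "unpaired_prob x E v =
     (\<Sum>m | m \<in> matchings E \<and> v \<notin> \<Union>m. prod x m) / (\<Sum>m\<in>matchings E. prod x m)"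

definition activity :: "('v \<Rightarrow> real) \<Rightarrow> ('v set \<Rightarrow> real) \<Rightarrow> 'v set \<Rightarrow> real" where
  "activity \<nu> \<omega> e = exp (\<omega> e - (\<Sum>v\<in>e. \<nu> v))"

definition separates :: "'v set \<Rightarrow> 'v set set \<Rightarrow> bool" where
  "separates A m \<longleftrightarrow> (\<forall>e\<in>m. e \<subseteq> A \<or> e \<inter> A = {})"

section \<open>Matchings, edge activities and the Gibbs average\<close>

lemma finite_matchings: "finite E \<Longrightarrow> finite (matchings E)"
  by (rule finite_subset[of _ "Pow E"]) (auto simp: matchings_def)

lemma empty_in_matchings: "{} \<in> matchings E"
  by (simp add: matchings_def)

lemma finite_in_matchings: "finite E \<Longrightarrow> m \<in> matchings E \<Longrightarrow> finite m"
  by (auto simp: matchings_def intro: finite_subset)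

lemma sum_matchings_pos:
  assumes "finite E" "\<And>e. e \<in> E \<Longrightarrow> 0 < x e"
  shows "0 < (\<Sum>m\<in>matchings E. prod x m :: real)"
proof (rule sum_pos)
  show "matchings E \<noteq> {}" using empty_in_matchings by blast
  show "0 < prod x m" if "m \<in> matchings E" for m
    using that assms(2) by (auto intro!: prod_pos simp: matchings_def)
qed (use assms finite_matchings in auto)

lemma unpaired_prob_nonneg:
  assumes "finite E" "\<And>e. e \<in> E \<Longrightarrow> 0 < x e"
  shows "0 \<le> unpaired_prob x E v"
  unfolding unpaired_prob_def
  by (intro divide_nonneg_nonneg sum_nonneg prod_nonneg)
     (auto simp: matchings_def intro!: less_imp_le[OF assms(2)])

lemma unpaired_prob_le_1:
  assumes "finite E" "\<And>e. e \<in> E \<Longrightarrow> 0 < x e"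
  shows "unpaired_prob x E v \<le> 1"
proof -
  have "(\<Sum>m | m \<in> matchings E \<and> v \<notin> \<Union>m. prod x m) \<le> (\<Sum>m\<in>matchings E. prod x m)"
    by (rule sum_mono2)
       (auto simp: finite_matchings assms matchings_def intro!: prod_nonneg less_imp_le[OF assms(2)])
  then show ?thesis
    unfolding unpaired_prob_def using sum_matchings_pos[OF assms] by simp
qed

text \<open>Every vertex is unpaired or lies in exactly one edge of \<open>m\<close>, so
  \<open>sum \<nu> V\<close> splits accordingly and the weights of paired vertices are charged to
  the edges. The factor \<open>exp (sum \<nu> V)\<close> is common to all matchings and cancels in
  the Gibbs measure.\<close>

lemma exp_hamiltonian_eq:
  assumes "finite V" "E \<subseteq> Pow V" "m \<in> matchings E"
  shows "exp (hamiltonian V \<nu> \<omega> m) = exp (sum \<nu> V) * prod (activity \<nu> \<omega>) m"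
proof -
  have m: "m \<subseteq> Pow V" "disjoint m"
    using assms by (auto simp: matchings_def)
  have fin: "finite m" "\<And>e. e \<in> m \<Longrightarrow> finite e"
    using m assms(1) by (auto intro: finite_subset[of _ "Pow V"] finite_subset[of _ V])
  have "sum \<nu> V = sum \<nu> (unpaired V m) + sum \<nu> (\<Union>m)"
    using assms(1) m finite_subset[of "\<Union>m" V] by (subst sum.union_disjoint[symmetric])
      (auto simp: unpaired_def intro!: sum.cong)
  also have "sum \<nu> (\<Union>m) = (\<Sum>e\<in>m. sum \<nu> e)"
    using m(2) fin by (subst sum.Union_disjoint) (auto simp: disjoint_def)
  finally have "hamiltonian V \<nu> \<omega> m = sum \<nu> V + (\<Sum>e\<in>m. \<omega> e - sum \<nu> e)"
    by (simp add: hamiltonian_def sum_subtractf)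
  then show ?thesis
    by (simp add: exp_add exp_sum fin activity_def)
qed

lemma gibbs_average_card_unpaired:
  assumes V: "finite V" and E: "E \<subseteq> Pow V"
  shows "gibbs_average V E \<nu> \<omega> (\<lambda>m. real (card (unpaired V m)))
           = (\<Sum>v\<in>V. unpaired_prob (activity \<nu> \<omega>) E v)"
proof -
  define x where "x = activity \<nu> \<omega>"
  define Z where "Z = (\<Sum>m\<in>matchings E. prod x m)"
  have finE: "finite E" using V E by (meson finite_Pow_iff finite_subset)
  have fin: "finite (matchings E)" by (simp add: finE finite_matchings)
  have pf: "partition_function V E \<nu> \<omega> = exp (sum \<nu> V) * Z"
    using exp_hamiltonian_eq[OF V E]
    by (simp add: partition_function_def Z_def x_def sum_distrib_left)
  have g: "gibbs V E \<nu> \<omega> m = prod x m / Z" if "m \<in> matchings E" for m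
    using exp_hamiltonian_eq[OF V E that] by (simp add: gibbs_def pf x_def)
  have "gibbs_average V E \<nu> \<omega> (\<lambda>m. real (card (unpaired V m)))
      = (\<Sum>m\<in>matchings E. (\<Sum>v\<in>V. if v \<notin> \<Union>m then 1 else 0) * (prod x m / Z))"
    unfolding gibbs_average_def
  proof (intro sum.cong refl arg_cong2[where f="(*)"] g)
    fix m
    have "unpaired V m = V \<inter> {v. v \<notin> \<Union>m}" by (auto simp: unpaired_def)
    then show "real (card (unpaired V m)) = (\<Sum>v\<in>V. if v \<notin> \<Union>m then 1 else 0)"
      using V by (simp add: sum.If_cases)
  qed
  also have "\<dots> = (\<Sum>v\<in>V. \<Sum>m\<in>matchings E. if v \<notin> \<Union>m then prod x m / Z else 0)"
    unfolding sum_distrib_right by (subst sum.swap) (intro sum.cong refl, simp)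
  also have "\<dots> = (\<Sum>v\<in>V. unpaired_prob x E v)"
    unfolding unpaired_prob_def Z_def[symmetric] sum_divide_distrib
    using fin by (intro sum.cong refl sum.inter_filter[symmetric])
  finally show ?thesis by (simp add: x_def)
qed

section \<open>Exchanging parts of two matchings\<close>

lemma prod_swap:
  fixes x :: "'e \<Rightarrow> real"
  assumes "finite m" "finite m'"
  shows "prod x (m' \<inter> B \<union> (m - B)) * prod x (m \<inter> B \<union> (m' - B)) = prod x m * prod x m'"
proof -
  have "prod x (m' \<inter> B \<union> (m - B)) = prod x (m' \<inter> B) * prod x (m - B)"
    "prod x (m \<inter> B \<union> (m' - B)) = prod x (m \<inter> B) * prod x (m' - B)"
    using assms by (auto intro!: prod.union_disjoint)
  moreover have "prod x m = prod x (m \<inter> B) * prod x (m - B)"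
    "prod x m' = prod x (m' \<inter> B) * prod x (m' - B)"
    using assms by (auto simp: prod.Int_Diff)
  ultimately show ?thesis by simp
qed

text \<open>By separation, the edges of \<open>m\<close> not inside \<open>A\<close> miss
  \<open>A\<close>, hence are disjoint from the imported edges of \<open>m'\<close>. The agreement
  of the two graphs inside \<open>A\<close> puts the imported edges into \<open>E\<close>.\<close>

lemma swap_in_matchings:
  assumes "m \<in> matchings E" "m' \<in> matchings E'" "separates A (m \<union> m')"
    and "E \<inter> Pow A = E' \<inter> Pow A"
  shows "m' \<inter> Pow A \<union> (m - Pow A) \<in> matchings E"
proof -
  have 1: "m' \<inter> Pow A \<union> (m - Pow A) \<subseteq> E"
    using assms by (auto simp: matchings_def)
  have mm: "disjoint m" "disjoint m'"
    using assms by (auto simp: matchings_def)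
  have out: "e \<inter> A = {}" if "e \<in> m - Pow A" for e
    using that assms(3) by (auto simp: separates_def)
  have "e \<inter> f = {}"
    if e: "e \<in> m' \<inter> Pow A \<union> (m - Pow A)" and f: "f \<in> m' \<inter> Pow A \<union> (m - Pow A)" and "e \<noteq> f" for e f
  proof (cases "e \<in> m' \<inter> Pow A \<longleftrightarrow> f \<in> m' \<inter> Pow A")
    case True
    then have "e \<in> m \<and> f \<in> m \<or> e \<in> m' \<and> f \<in> m'"
      using e f by auto
    then show ?thesis using mm \<open>e \<noteq> f\<close> unfolding disjoint_def by blast
  next
    case False
    then have "e \<subseteq> A \<and> f \<in> m - Pow A \<or> f \<subseteq> A \<and> e \<in> m - Pow A"
      using e f by auto
    then show ?thesis using out by blast
  qed
  with 1 show ?thesis by (auto simp: matchings_def disjoint_def)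
qed

text \<open>Exchanging the parts of two matchings inside a set whose boundary neither of them crosses.
  The set is chosen as a function of the union of the two matchings, which the exchange does not
  change; so the exchange is an involution.\<close>

lemma sum_pairs_swap:
  fixes x :: "'v set \<Rightarrow> real"
  assumes fin: "finite E" "finite E'"
    and EE: "\<And>s. s \<in> S \<Longrightarrow> E \<inter> Pow (A s) = E' \<inter> Pow (A s)"
    and v: "\<And>s. s \<in> S \<Longrightarrow> v \<in> A s"
  defines "\<Omega> \<equiv> {(m, m'). m \<in> matchings E \<and> m' \<in> matchings E' \<and> (\<exists>s\<in>S. separates (A s) (m \<union> m'))}"
  shows "(\<Sum>(m, m')\<in>\<Omega>. if v \<notin> \<Union>m then prod x m * prod x m' else 0)
       = (\<Sum>(m, m')\<in>\<Omega>. if v \<notin> \<Union>m' then prod x m * prod x m' else 0)"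
proof -
  define B where "B M = Pow (A (SOME s. s \<in> S \<and> separates (A s) M))" for M
  define T where "T = (\<lambda>(m, m').
    (m' \<inter> B (m \<union> m') \<union> (m - B (m \<union> m')), m \<inter> B (m \<union> m') \<union> (m' - B (m \<union> m'))))"
  have B: "\<exists>s\<in>S. B (m \<union> m') = Pow (A s) \<and> separates (A s) (m \<union> m')" if "(m, m') \<in> \<Omega>" for m m'
  proof -
    have "\<exists>s. s \<in> S \<and> separates (A s) (m \<union> m')" using that by (auto simp: \<Omega>_def)
    from someI_ex[OF this] show ?thesis unfolding B_def by blast
  qed
  have un: "fst (T p) \<union> snd (T p) = fst p \<union> snd p" for p
    by (auto simp: T_def split: prod.splits)
  have TT: "T (T p) = p" for p
  proof -
    obtain m m' where p: "p = (m, m')" by force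
    obtain n n' where q: "T p = (n, n')" by force
    have u: "n \<union> n' = m \<union> m'" using un[of p] p q by simp
    have "n = m' \<inter> B (m \<union> m') \<union> (m - B (m \<union> m'))" "n' = m \<inter> B (m \<union> m') \<union> (m' - B (m \<union> m'))"
      using p q by (simp_all add: T_def)
    then have "n' \<inter> B (m \<union> m') \<union> (n - B (m \<union> m')) = m" "n \<inter> B (m \<union> m') \<union> (n' - B (m \<union> m')) = m'"
      by blast+
    then have "T (n, n') = (m, m')"
      by (simp add: T_def u)
    then show ?thesis using p q by simp
  qed
  have T_in: "T p \<in> \<Omega>" if p: "p \<in> \<Omega>" for p
  proof -
    obtain m m' where mm: "p = (m, m')" by force
    obtain n n' where q: "T p = (n, n')" by force
    have u: "n \<union> n' = m \<union> m'" using un[of p] mm q by simp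
    obtain s where s: "s \<in> S" "B (m \<union> m') = Pow (A s)" "separates (A s) (m \<union> m')"
      using B p mm by blast
    have m: "m \<in> matchings E" "m' \<in> matchings E'" using p mm by (auto simp: \<Omega>_def)
    have "n \<in> matchings E"
      using swap_in_matchings[OF m s(3) EE[OF s(1)]] q mm s(2) by (simp add: T_def)
    moreover have "n' \<in> matchings E'"
      using swap_in_matchings[OF m(2,1), of "A s"] s EE[OF s(1)] q mm
      by (simp add: T_def Un_commute)
    ultimately show ?thesis using q u s by (auto simp: \<Omega>_def)
  qed
  show ?thesis
  proof (rule sum.reindex_bij_witness[of _ T T])
    fix p assume p: "p \<in> \<Omega>"
    obtain m m' where mm: "p = (m, m')" by force
    obtain n n' where q: "T p = (n, n')" by force
    obtain s where s: "s \<in> S" "B (m \<union> m') = Pow (A s)" "separates (A s) (m \<union> m')"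
      using B p mm by blast
    have m: "m \<in> matchings E" "m' \<in> matchings E'" using p mm by (auto simp: \<Omega>_def)
    have n: "n = m' \<inter> Pow (A s) \<union> (m - Pow (A s))" "n' = m \<inter> Pow (A s) \<union> (m' - Pow (A s))"
      using mm q s by (simp_all add: T_def)
    \<comment> \<open>Since \<open>v\<close> lies in \<open>A s\<close>, every edge of either
      matching that covers \<open>v\<close> lies inside \<open>A s\<close> and is moved by the
      exchange.\<close>
    have "v \<notin> \<Union>n' \<longleftrightarrow> v \<notin> \<Union>m"
    proof -
      have "e \<subseteq> A s" if "e \<in> m \<union> m'" "v \<in> e" for e
        using that v[OF s(1)] s(3) by (auto simp: separates_def)
      then show ?thesis unfolding n by blast
    qed
    moreover have "prod x n * prod x n' = prod x m * prod x m'"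
      unfolding n using m fin by (intro prod_swap) (auto intro: finite_in_matchings)
    ultimately show "(case T p of (m, m') \<Rightarrow> if v \<notin> \<Union> m' then prod x m * prod x m' else 0) =
         (case p of (m, m') \<Rightarrow> if v \<notin> \<Union> m then prod x m * prod x m' else 0)"
      unfolding q unfolding mm by simp
  qed (use TT T_in in auto)
qed

section \<open>Pairs of matchings that no set of a family separates\<close>

lemma sum_Pow_prod:
  fixes x :: "'e \<Rightarrow> real"
  assumes "finite C"
  shows "(\<Sum>X\<in>Pow C. prod x X) = (\<Prod>e\<in>C. 1 + x e)"
  using prod_add[OF assms, of x "\<lambda>_. 1"] by (simp add: add.commute)

definition unseparated_pairs ::
  "'v set set \<Rightarrow> 'v set set \<Rightarrow> ('s \<Rightarrow> 'v set) \<Rightarrow> 's set \<Rightarrow> ('v set set \<times> 'v set set) set" where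
  "unseparated_pairs E E' A S =
     {(m, m'). m \<in> matchings E \<and> m' \<in> matchings E' \<and> (\<forall>s\<in>S. \<not> separates (A s) (m \<union> m'))}"

lemma finite_unseparated_pairs:
  assumes "finite E" "finite E'"
  shows "finite (unseparated_pairs E E' A S)"
  by (rule finite_subset[of _ "matchings E \<times> matchings E'"])
     (auto simp: unseparated_pairs_def finite_matchings assms)

text \<open>Deleting the edges of a pair of matchings that cross the boundary of \<open>A s\<close> produces a pair
  separated by \<open>A s\<close>; each such pair arises from a total weight of at most
  \<open>(\<Prod>e\<in>C. 1 + x e)\<^sup>2\<close> times its own.\<close>

lemma sum_unseparated_pairs_insert:
  fixes x :: "'v set \<Rightarrow> real"
  assumes fin: "finite E" "finite E'" "finite C" and x: "\<And>e. 0 < x e"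
    and C: "\<And>e. e \<in> E \<union> E' \<Longrightarrow> e \<subseteq> A s \<or> e \<inter> A s = {} \<or> e \<in> C"
    and stable: "\<And>e t. e \<in> C \<Longrightarrow> t \<in> S \<Longrightarrow> e \<subseteq> A t \<or> e \<inter> A t = {}"
  shows "(\<Sum>(m, m')\<in>unseparated_pairs E E' A (insert s S). prod x m * prod x m')
    \<le> (1 - (\<Prod>e\<in>C. 1 / (1 + x e))\<^sup>2) * (\<Sum>(m, m')\<in>unseparated_pairs E E' A S. prod x m * prod x m')"
proof -
  define w where "w = (\<lambda>(m, m'). prod x m * prod x m')"
  define k where "k = (\<Prod>e\<in>C. 1 + x e)"
  define Q where "Q = unseparated_pairs E E' A S"
  define T where "T = {p \<in> Q. separates (A s) (fst p \<union> snd p)}"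
  \<comment> \<open>A pair is encoded by what survives the deletion and by what is deleted. The
    weight is multiplicative along this splitting and the encoding is injective, so the sum over
    \<open>Q\<close> is at most the sum over a full product set.\<close>
  define \<phi> where "\<phi> = (\<lambda>(m, m'). ((m - C, m' - C), (m \<inter> C, m' \<inter> C)))"
  define g where "g = (\<lambda>(p, q). w p * w q)"
  have finQ: "finite Q" using fin finite_unseparated_pairs by (auto simp: Q_def)
  then have finT: "finite T" by (auto simp: T_def)
  have w_nonneg: "0 \<le> w p" for p
    by (auto simp: w_def split: prod.splits intro!: mult_nonneg_nonneg prod_nonneg less_imp_le[OF x])
  have k_pos: "0 < k" unfolding k_def by (intro prod_pos) (use x in \<open>auto intro: add_pos_pos\<close>)
  have inj: "inj_on \<phi> Q"
  proof (rule inj_onI)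
    fix p q assume "\<phi> p = \<phi> q"
    moreover have "fst p = fst (fst (\<phi> p)) \<union> fst (snd (\<phi> p))"
      "snd p = snd (fst (\<phi> p)) \<union> snd (snd (\<phi> p))" for p
      by (auto simp: \<phi>_def split: prod.splits)
    ultimately show "p = q" by (metis prod.expand)
  qed
  have sub: "\<phi> ` Q \<subseteq> T \<times> (Pow C \<times> Pow C)"
  proof
    fix r assume "r \<in> \<phi> ` Q"
    then obtain m m' where p: "(m, m') \<in> Q" and r: "r = ((m - C, m' - C), (m \<inter> C, m' \<inter> C))"
      by (auto simp: \<phi>_def)
    have m: "m \<in> matchings E" "m' \<in> matchings E'" and
      ns: "\<And>t. t \<in> S \<Longrightarrow> \<not> separates (A t) (m \<union> m')"
      using p by (auto simp: Q_def unseparated_pairs_def)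
    have "m - C \<in> matchings E" "m' - C \<in> matchings E'"
      using m by (auto simp: matchings_def disjoint_def)
    \<comment> \<open>The deletion cannot make \<open>A t\<close> separating: by
      \<open>stable\<close>, no deleted edge crosses its boundary.\<close>
    moreover have "\<not> separates (A t) ((m - C) \<union> (m' - C))" if "t \<in> S" for t
      using ns[OF that] stable[OF _ that] unfolding separates_def by blast
    moreover have "separates (A s) ((m - C) \<union> (m' - C))"
    proof -
      have "e \<in> E \<union> E'" if "e \<in> m \<union> m'" for e using that m by (auto simp: matchings_def)
      then show ?thesis using C unfolding separates_def by blast
    qed
    ultimately show "r \<in> T \<times> (Pow C \<times> Pow C)"
      by (auto simp: r T_def Q_def unseparated_pairs_def)
  qed
  have "sum w Q = (\<Sum>p\<in>Q. g (\<phi> p))"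
  proof (rule sum.cong)
    fix p assume "p \<in> Q"
    then obtain m m' where p: "p = (m, m')" "finite m" "finite m'"
      using fin by (auto simp: Q_def unseparated_pairs_def finite_in_matchings)
    have "prod x m = prod x (m \<inter> C) * prod x (m - C)" "prod x m' = prod x (m' \<inter> C) * prod x (m' - C)"
      using p by (auto simp: prod.Int_Diff)
    then show "w p = g (\<phi> p)" by (simp add: p(1) w_def g_def \<phi>_def)
  qed simp
  also have "\<dots> = sum g (\<phi> ` Q)" by (simp add: sum.reindex[OF inj])
  also have "\<dots> \<le> sum g (T \<times> (Pow C \<times> Pow C))"
    using sub finT fin(3) w_nonneg
    by (intro sum_mono2) (auto simp: g_def split: prod.splits intro!: mult_nonneg_nonneg)
  also have "\<dots> = sum w T * sum w (Pow C \<times> Pow C)"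
    by (simp add: g_def sum_product sum.cartesian_product split_def)
  also have "sum w (Pow C \<times> Pow C) = k\<^sup>2"
    unfolding k_def power2_eq_square sum_Pow_prod[OF fin(3), of x, symmetric]
    by (simp only: w_def sum_product sum.cartesian_product)
  finally have le: "sum w Q / k\<^sup>2 \<le> sum w T"
    using k_pos by (simp add: field_simps)
  have "unseparated_pairs E E' A (insert s S) = Q - T"
    by (auto simp: Q_def T_def unseparated_pairs_def)
  then have "(\<Sum>(m, m')\<in>unseparated_pairs E E' A (insert s S). prod x m * prod x m') = sum w Q - sum w T"
    using finQ sum_diff[of Q T w] by (auto simp: w_def T_def)
  also have "\<dots> \<le> (1 - 1 / k\<^sup>2) * sum w Q"
    using le by (simp add: algebra_simps)
  also have "1 / k\<^sup>2 = (\<Prod>e\<in>C. 1 / (1 + x e))\<^sup>2"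
    by (simp add: k_def prod_dividef power_divide)
  finally show ?thesis by (simp add: Q_def w_def)
qed

text \<open>The factors multiply although crossings of different boundaries need not be independent:
  each insertion bounds a share of those pairs that the remaining sets leave unseparated.\<close>

lemma sum_unseparated_pairs_le:
  fixes x :: "'v set \<Rightarrow> real"
  assumes "finite S" and fin: "finite E" "finite E'" "\<And>s. finite (C s)" and x: "\<And>e. 0 < x e"
    and C: "\<And>e s. e \<in> E \<union> E' \<Longrightarrow> s \<in> S \<Longrightarrow> e \<subseteq> A s \<or> e \<inter> A s = {} \<or> e \<in> C s"
    and stable: "\<And>e s t. s \<in> S \<Longrightarrow> t \<in> S \<Longrightarrow> s \<noteq> t \<Longrightarrow> e \<in> C s \<Longrightarrow> e \<subseteq> A t \<or> e \<inter> A t = {}"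
  shows "(\<Sum>(m, m')\<in>unseparated_pairs E E' A S. prod x m * prod x m')
    \<le> (\<Prod>s\<in>S. 1 - (\<Prod>e\<in>C s. 1 / (1 + x e))\<^sup>2) *
       ((\<Sum>m\<in>matchings E. prod x m) * (\<Sum>m\<in>matchings E'. prod x m))"
  using \<open>finite S\<close> C stable
proof (induction S rule: finite_induct)
  case empty
  have "unseparated_pairs E E' A {} = matchings E \<times> matchings E'"
    by (auto simp: unseparated_pairs_def)
  then show ?case by (simp add: sum_product sum.cartesian_product)
next
  case (insert s S)
  have "0 \<le> (\<Prod>e\<in>C s. 1 / (1 + x e))" "(\<Prod>e\<in>C s. 1 / (1 + x e)) \<le> 1"
    using x by (auto intro!: prod_nonneg prod_le_1 simp: less_imp_le add_nonneg_nonneg add_pos_pos)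
  then have c: "0 \<le> 1 - (\<Prod>e\<in>C s. 1 / (1 + x e))\<^sup>2"
    by (simp add: power_le_one)
  have "(\<Sum>(m, m')\<in>unseparated_pairs E E' A (insert s S). prod x m * prod x m')
      \<le> (1 - (\<Prod>e\<in>C s. 1 / (1 + x e))\<^sup>2) * (\<Sum>(m, m')\<in>unseparated_pairs E E' A S. prod x m * prod x m')"
  proof (rule sum_unseparated_pairs_insert[OF fin(1,2,3) x])
    show "e \<subseteq> A s \<or> e \<inter> A s = {} \<or> e \<in> C s" if "e \<in> E \<union> E'" for e
      using insert.prems(1)[OF that, of s] by simp
    show "e \<subseteq> A t \<or> e \<inter> A t = {}" if "e \<in> C s" "t \<in> S" for e t
      using insert.prems(2)[of s t e] insert.hyps that by auto
  qed
  also have "\<dots> \<le> (1 - (\<Prod>e\<in>C s. 1 / (1 + x e))\<^sup>2) *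
      ((\<Prod>s\<in>S. 1 - (\<Prod>e\<in>C s. 1 / (1 + x e))\<^sup>2) *
       ((\<Sum>m\<in>matchings E. prod x m) * (\<Sum>m\<in>matchings E'. prod x m)))"
    by (intro mult_left_mono insert.IH c insert.prems) (use insert.prems in auto)
  finally show ?case using insert.hyps by (simp add: mult.assoc)
qed

text \<open>Multiplied by both partition functions, the difference becomes a sum over pairs of
  matchings. The exchange cancels the pairs separated by some \<open>A s\<close>; every other pair
  contributes at most its weight.\<close>

lemma unpaired_prob_diff_le:
  fixes x :: "'v set \<Rightarrow> real"
  assumes "finite S" and fin: "finite E" "finite E'" "\<And>s. finite (C s)" and x: "\<And>e. 0 < x e"
    and EE: "\<And>s. s \<in> S \<Longrightarrow> E \<inter> Pow (A s) = E' \<inter> Pow (A s)"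
    and v: "\<And>s. s \<in> S \<Longrightarrow> v \<in> A s"
    and C: "\<And>e s. e \<in> E \<union> E' \<Longrightarrow> s \<in> S \<Longrightarrow> e \<subseteq> A s \<or> e \<inter> A s = {} \<or> e \<in> C s"
    and stable: "\<And>e s t. s \<in> S \<Longrightarrow> t \<in> S \<Longrightarrow> s \<noteq> t \<Longrightarrow> e \<in> C s \<Longrightarrow> e \<subseteq> A t \<or> e \<inter> A t = {}"
  shows "\<bar>unpaired_prob x E v - unpaired_prob x E' v\<bar>
    \<le> (\<Prod>s\<in>S. 1 - (\<Prod>e\<in>C s. 1 / (1 + x e))\<^sup>2)"
proof -
  define M where "M = matchings E \<times> matchings E'"
  define U where "U = unseparated_pairs E E' A S"
  define w where "w p = prod x (fst p) * prod x (snd p)" for p :: "'v set set \<times> 'v set set"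
  define f where "f p = (if v \<notin> \<Union>(fst p) then w p else 0)" for p :: "'v set set \<times> 'v set set"
  define f' where "f' p = (if v \<notin> \<Union>(snd p) then w p else 0)" for p :: "'v set set \<times> 'v set set"
  define Z where "Z = (\<Sum>m\<in>matchings E. prod x m)"
  define Z' where "Z' = (\<Sum>m\<in>matchings E'. prod x m)"
  have Z: "0 < Z" "0 < Z'"
    unfolding Z_def Z'_def using fin x by (auto intro: sum_matchings_pos)
  have finM: "finite M" using fin by (simp add: M_def finite_matchings)
  have w_nonneg: "0 \<le> w p" for p
    by (auto simp: w_def intro!: mult_nonneg_nonneg prod_nonneg less_imp_le[OF x])
  have f: "sum f M = Z * Z' * unpaired_prob x E v"
  proof -
    have "sum f M = (\<Sum>m\<in>matchings E. \<Sum>m'\<in>matchings E'. (if v \<notin> \<Union>m then prod x m else 0) * prod x m')"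
      unfolding M_def sum.cartesian_product by (rule sum.cong) (auto simp: f_def w_def)
    also have "\<dots> = (\<Sum>m\<in>matchings E. if v \<notin> \<Union>m then prod x m else 0) * Z'"
      by (simp only: Z'_def sum_product)
    also have "(\<Sum>m\<in>matchings E. if v \<notin> \<Union>m then prod x m else 0) = Z * unpaired_prob x E v"
      using Z fin by (simp add: unpaired_prob_def Z_def[symmetric] sum.inter_filter[symmetric] finite_matchings)
    finally show ?thesis by simp
  qed
  have f': "sum f' M = Z * Z' * unpaired_prob x E' v"
  proof -
    have "sum f' M = (\<Sum>m\<in>matchings E. \<Sum>m'\<in>matchings E'. prod x m * (if v \<notin> \<Union>m' then prod x m' else 0))"
      unfolding M_def sum.cartesian_product by (rule sum.cong) (auto simp: f'_def w_def)
    also have "\<dots> = Z * (\<Sum>m\<in>matchings E'. if v \<notin> \<Union>m then prod x m else 0)"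
      by (simp only: Z_def sum_product)
    also have "(\<Sum>m\<in>matchings E'. if v \<notin> \<Union>m then prod x m else 0) = Z' * unpaired_prob x E' v"
      using Z fin by (simp add: unpaired_prob_def Z'_def[symmetric] sum.inter_filter[symmetric] finite_matchings)
    finally show ?thesis by simp
  qed
  have U: "U \<subseteq> M" by (auto simp: U_def M_def unseparated_pairs_def)
  have MU: "M - U = {(m, m'). m \<in> matchings E \<and> m' \<in> matchings E' \<and> (\<exists>s\<in>S. separates (A s) (m \<union> m'))}"
    by (auto simp: U_def M_def unseparated_pairs_def)
  have "sum f (M - U) = sum f' (M - U)"
    using sum_pairs_swap[where x=x and E=E and E'=E' and S=S and A=A and v=v, OF fin(1,2) EE v]
    unfolding MU f_def f'_def w_def by (simp add: split_def)
  then have "sum f M - sum f' M = sum f U - sum f' U"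
    using sum.subset_diff[OF U finM, of f] sum.subset_diff[OF U finM, of f'] by simp
  also have "\<bar>\<dots>\<bar> \<le> sum w U"
    unfolding sum_subtractf[symmetric]
    by (rule order.trans[OF sum_abs sum_mono]) (auto simp: f_def f'_def w_nonneg)
  also have "\<dots> \<le> (\<Prod>s\<in>S. 1 - (\<Prod>e\<in>C s. 1 / (1 + x e))\<^sup>2) * (Z * Z')"
    using sum_unseparated_pairs_le[where x=x and E=E and E'=E' and S=S and A=A and C=C, OF assms(1) fin x C stable]
    by (simp add: U_def w_def Z_def Z'_def split_def)
  also have "sum f M - sum f' M = (unpaired_prob x E v - unpaired_prob x E' v) * (Z * Z')"
    by (simp add: f f' algebra_simps)
  finally show ?thesis
    using Z by (simp add: abs_mult)
qed

section \<open>Cylinder graphs\<close>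

definition slab :: "'h set \<Rightarrow> nat \<Rightarrow> nat \<Rightarrow> (nat \<times> 'h) set" where
  "slab VH a b = {a<..b} \<times> VH"

text \<open>The subgraph induced in the infinite cylinder. In this form, two slabs with the same
  vertices inside a set also have the same edges inside it, as the exchange requires.\<close>

definition slab_edges :: "'h set \<Rightarrow> 'h set set \<Rightarrow> nat \<Rightarrow> nat \<Rightarrow> (nat \<times> 'h) set set" where
  "slab_edges VH EH a b = (\<Union>n. cyl_edges VH EH n) \<inter> Pow (slab VH a b)"

definition cut_edges :: "'h set \<Rightarrow> nat \<Rightarrow> (nat \<times> 'h) set set" where
  "cut_edges VH s = (\<lambda>j. {(s, j), (s + 1, j)}) ` VH"

definition layer_shift :: "nat \<Rightarrow> nat \<times> 'h \<Rightarrow> nat \<times> 'h" where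
  "layer_shift a = (\<lambda>(i, j). (i + a, j))"

definition slab_unpaired ::
  "'h set \<Rightarrow> 'h set set \<Rightarrow> ((nat \<times> 'h) set \<Rightarrow> real) \<Rightarrow> nat \<Rightarrow> nat \<Rightarrow> real" where
  "slab_unpaired VH EH x a b = (\<Sum>v\<in>slab VH a b. unpaired_prob x (slab_edges VH EH a b) v)"

text \<open>Upper bound for the conditional probability that at least one of two independent
  matchings crosses the cut between the layers \<open>s\<close> and \<open>s + 1\<close>.\<close>

definition block_prob :: "'h set \<Rightarrow> ((nat \<times> 'h) set \<Rightarrow> real) \<Rightarrow> nat \<Rightarrow> real" where
  "block_prob VH x s = 1 - (\<Prod>e\<in>cut_edges VH s. 1 / (1 + x e))\<^sup>2"

lemma cyl_edges_iff:
  "e \<in> cyl_edges VH EH n \<longleftrightarrow>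
     (\<exists>i j. 1 \<le> i \<and> i + 1 \<le> n \<and> j \<in> VH \<and> e = {(i, j), (i + 1, j)}) \<or>
     (\<exists>i j j'. 1 \<le> i \<and> i \<le> n \<and> j \<in> VH \<and> j' \<in> VH \<and> {j, j'} \<in> EH \<and> e = {(i, j), (i, j')})"
proof
  assume "e \<in> cyl_edges VH EH n"
  then obtain i j i' j' where e: "e = {(i, j), (i', j')}" "i \<in> {1..n}" "i' \<in> {1..n}" "j \<in> VH" "j' \<in> VH"
    "{i, i'} \<in> path_edges n \<and> j = j' \<or> i = i' \<and> {j, j'} \<in> EH"
    unfolding cyl_edges_def cart_edges_def path_verts_def by blast
  show "(\<exists>i j. 1 \<le> i \<and> i + 1 \<le> n \<and> j \<in> VH \<and> e = {(i, j), (i + 1, j)}) \<or>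
     (\<exists>i j j'. 1 \<le> i \<and> i \<le> n \<and> j \<in> VH \<and> j' \<in> VH \<and> {j, j'} \<in> EH \<and> e = {(i, j), (i, j')})"
  proof (cases "i = i' \<and> {j, j'} \<in> EH")
    case True
    then show ?thesis using e
      by (intro disjI2 exI[of _ i] exI[of _ j] exI[of _ j']) auto
  next
    case False
    then have jj: "j = j'" and "{i, i'} \<in> path_edges n" using e(6) by auto
    then obtain k where k: "{i, i'} = {k, k + 1}" "1 \<le> k" "k + 1 \<le> n"
      by (auto simp: path_edges_def)
    then have "e = {(k, j), (k + 1, j)}"
      using e(1) jj by (auto simp: doubleton_eq_iff)
    then show ?thesis using k e(4) by blast
  qed
next
  assume "(\<exists>i j. 1 \<le> i \<and> i + 1 \<le> n \<and> j \<in> VH \<and> e = {(i, j), (i + 1, j)}) \<or>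
     (\<exists>i j j'. 1 \<le> i \<and> i \<le> n \<and> j \<in> VH \<and> j' \<in> VH \<and> {j, j'} \<in> EH \<and> e = {(i, j), (i, j')})"
  then show "e \<in> cyl_edges VH EH n"
  proof (elim disjE exE conjE)
    fix i j assume "1 \<le> i" "i + 1 \<le> n" "j \<in> VH" "e = {(i, j), (i + 1, j)}"
    moreover from this have "{i, i + 1} \<in> path_edges n" by (auto simp: path_edges_def)
    ultimately show ?thesis
      unfolding cyl_edges_def cart_edges_def path_verts_def
      by (intro CollectI exI[of _ i] exI[of _ j] exI[of _ "i + 1"] exI[of _ j]) auto
  next
    fix i j j' assume "1 \<le> i" "i \<le> n" "j \<in> VH" "j' \<in> VH" "{j, j'} \<in> EH" "e = {(i, j), (i, j')}"
    then show ?thesis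
      unfolding cyl_edges_def cart_edges_def path_verts_def
      by (intro CollectI exI[of _ i] exI[of _ j] exI[of _ i] exI[of _ j']) auto
  qed
qed

lemma slab_edges_iff:
  "e \<in> slab_edges VH EH a b \<longleftrightarrow>
     (\<exists>i j. a < i \<and> i + 1 \<le> b \<and> j \<in> VH \<and> e = {(i, j), (i + 1, j)}) \<or>
     (\<exists>i j j'. a < i \<and> i \<le> b \<and> j \<in> VH \<and> j' \<in> VH \<and> {j, j'} \<in> EH \<and> e = {(i, j), (i, j')})"
proof
  assume "e \<in> slab_edges VH EH a b"
  then obtain n where "e \<in> cyl_edges VH EH n" and sub: "e \<subseteq> slab VH a b"
    by (auto simp: slab_edges_def)
  then consider i j where "j \<in> VH" "e = {(i, j), (i + 1, j)}"
    | i j j' where "j \<in> VH" "j' \<in> VH" "{j, j'} \<in> EH" "e = {(i, j), (i, j')}"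
    unfolding cyl_edges_iff by blast
  then show "(\<exists>i j. a < i \<and> i + 1 \<le> b \<and> j \<in> VH \<and> e = {(i, j), (i + 1, j)}) \<or>
     (\<exists>i j j'. a < i \<and> i \<le> b \<and> j \<in> VH \<and> j' \<in> VH \<and> {j, j'} \<in> EH \<and> e = {(i, j), (i, j')})"
  proof cases
    case (1 i j)
    then show ?thesis using sub
      by (intro disjI1 exI[of _ i] exI[of _ j]) (auto simp: slab_def)
  next
    case (2 i j j')
    then show ?thesis using sub
      by (intro disjI2 exI[of _ i] exI[of _ j] exI[of _ j']) (auto simp: slab_def)
  qed
next
  assume "(\<exists>i j. a < i \<and> i + 1 \<le> b \<and> j \<in> VH \<and> e = {(i, j), (i + 1, j)}) \<or>
     (\<exists>i j j'. a < i \<and> i \<le> b \<and> j \<in> VH \<and> j' \<in> VH \<and> {j, j'} \<in> EH \<and> e = {(i, j), (i, j')})"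
  then show "e \<in> slab_edges VH EH a b"
  proof (elim disjE exE conjE)
    fix i j assume i: "a < i" "i + 1 \<le> b" "j \<in> VH" "e = {(i, j), (i + 1, j)}"
    then have "e \<in> cyl_edges VH EH b"
      unfolding cyl_edges_iff by (intro disjI1 exI[of _ i] exI[of _ j]) auto
    then show ?thesis using i by (auto simp: slab_edges_def slab_def)
  next
    fix i j j' assume i: "a < i" "i \<le> b" "j \<in> VH" "j' \<in> VH" "{j, j'} \<in> EH" "e = {(i, j), (i, j')}"
    then have "e \<in> cyl_edges VH EH b"
      unfolding cyl_edges_iff by (intro disjI2 exI[of _ i] exI[of _ j] exI[of _ j']) auto
    then show ?thesis using i by (auto simp: slab_edges_def slab_def)
  qed
qed

lemma cyl_verts_eq_slab: "cyl_verts VH n = slab VH 0 n"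
  by (auto simp: cyl_verts_def slab_def path_verts_def)

lemma cyl_edges_eq_slab_edges: "cyl_edges VH EH n = slab_edges VH EH 0 n"
  by (auto simp: slab_edges_iff cyl_edges_iff Suc_le_eq)

lemma finite_slab: "finite VH \<Longrightarrow> finite (slab VH a b)"
  by (simp add: slab_def)

lemma slab_edges_subset: "slab_edges VH EH a b \<subseteq> Pow (slab VH a b)"
  by (auto simp: slab_edges_def)

lemma finite_slab_edges: "finite VH \<Longrightarrow> finite (slab_edges VH EH a b)"
  using finite_subset[OF slab_edges_subset] finite_slab by blast

lemma finite_cut_edges: "finite VH \<Longrightarrow> finite (cut_edges VH s)"
  by (simp add: cut_edges_def)

lemma avg_unpaired_eq:
  assumes "finite VH"
  shows "avg_unpaired VH EH n \<nu> \<omega> = slab_unpaired VH EH (activity \<nu> \<omega>) 0 n"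
  using gibbs_average_card_unpaired[OF finite_slab[OF assms] slab_edges_subset]
  by (simp add: avg_unpaired_def slab_unpaired_def cyl_verts_eq_slab cyl_edges_eq_slab_edges)

lemma slab_unpaired_bounds:
  assumes "finite VH" "\<And>e. 0 < x e"
  shows "0 \<le> slab_unpaired VH EH x a b" "slab_unpaired VH EH x a b \<le> real (b - a) * card VH"
proof -
  show "0 \<le> slab_unpaired VH EH x a b"
    unfolding slab_unpaired_def using assms
    by (intro sum_nonneg unpaired_prob_nonneg finite_slab_edges) auto
  have "slab_unpaired VH EH x a b \<le> real (card (slab VH a b)) * 1"
    unfolding slab_unpaired_def using assms
    by (intro sum_bounded_above unpaired_prob_le_1 finite_slab_edges) auto
  then show "slab_unpaired VH EH x a b \<le> real (b - a) * card VH"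
    by (simp add: slab_def card_cartesian_product)
qed

lemma block_prob_bounds:
  assumes "\<And>e. 0 < x e"
  shows "0 \<le> block_prob VH x s" "block_prob VH x s < 1"
proof -
  have "0 < (\<Prod>e\<in>cut_edges VH s. 1 / (1 + x e))" "(\<Prod>e\<in>cut_edges VH s. 1 / (1 + x e)) \<le> 1"
    using assms by (auto intro!: prod_pos prod_le_1 simp: less_imp_le add_nonneg_nonneg add_pos_pos)
  then show "0 \<le> block_prob VH x s" "block_prob VH x s < 1"
    by (simp_all add: block_prob_def power_le_one)
qed

section \<open>The influence of distant layers\<close>

lemma unpaired_prob_cut_right:
  fixes x :: "(nat \<times> 'h) set \<Rightarrow> real"
  assumes VH: "finite VH" and x: "\<And>e. 0 < x e" and i: "a < i" "i \<le> b" "b \<le> c"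
  shows "\<bar>unpaired_prob x (slab_edges VH EH a c) (i, j) - unpaired_prob x (slab_edges VH EH a b) (i, j)\<bar>
    \<le> (\<Prod>k<(b - i) div 2. block_prob VH x (i + 2 * k))"
proof -
  \<comment> \<open>The cuts start at \<open>i\<close>, so that the vertex lies below each of them,
    and stay below \<open>b\<close>, so that the two graphs agree below each. Step 2 is for the
    independence of the factors under random weights.\<close>
  define S where "S = (\<lambda>k. i + 2 * k) ` {..<(b - i) div 2}"
  define A :: "nat \<Rightarrow> (nat \<times> 'h) set" where "A s = {..s} \<times> UNIV" for s
  have S: "i \<le> s" "s < b" if "s \<in> S" for s using that by (auto simp: S_def)
  have "\<bar>unpaired_prob x (slab_edges VH EH a c) (i, j) - unpaired_prob x (slab_edges VH EH a b) (i, j)\<bar>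
      \<le> (\<Prod>s\<in>S. 1 - (\<Prod>e\<in>cut_edges VH s. 1 / (1 + x e))\<^sup>2)"
  proof (rule unpaired_prob_diff_le[where A=A])
    show "slab_edges VH EH a c \<inter> Pow (A s) = slab_edges VH EH a b \<inter> Pow (A s)" if "s \<in> S" for s
    proof -
      have "slab VH a c \<inter> A s = slab VH a b \<inter> A s"
        using S[OF that] i by (auto simp: slab_def A_def)
      then show ?thesis by (auto simp: slab_edges_def)
    qed
    show "e \<subseteq> A s \<or> e \<inter> A s = {} \<or> e \<in> cut_edges VH s"
      if "e \<in> slab_edges VH EH a c \<union> slab_edges VH EH a b" for e s
    proof -
      from that consider i j where "j \<in> VH" "e = {(i, j), (i + 1, j)}" | i j j' where "e = {(i, j), (i, j')}"
        unfolding slab_edges_iff Un_iff by blast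
      then show ?thesis
      proof cases
        case (1 i j)
        then show ?thesis by (cases "i = s") (auto simp: A_def cut_edges_def)
      qed (auto simp: A_def)
    qed
    show "e \<subseteq> A t \<or> e \<inter> A t = {}" if "s \<noteq> t" "e \<in> cut_edges VH s" for e s t
      using that by (auto simp: A_def cut_edges_def)
    show "(i, j) \<in> A s" if "s \<in> S" for s using S[OF that] by (simp add: A_def)
  qed (use VH x in \<open>auto simp: S_def finite_slab_edges finite_cut_edges\<close>)
  also have "\<dots> = (\<Prod>k<(b - i) div 2. block_prob VH x (i + 2 * k))"
    unfolding S_def block_prob_def by (subst prod.reindex) (auto simp: inj_on_def)
  finally show ?thesis .
qed

lemma unpaired_prob_cut_left:
  fixes x :: "(nat \<times> 'h) set \<Rightarrow> real"
  assumes VH: "finite VH" and x: "\<And>e. 0 < x e" and i: "a \<le> b" "b < i" "i \<le> c"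
  shows "\<bar>unpaired_prob x (slab_edges VH EH a c) (i, j) - unpaired_prob x (slab_edges VH EH b c) (i, j)\<bar>
    \<le> (\<Prod>k<(i - b - 1) div 2. block_prob VH x (b + 1 + 2 * k))"
proof -
  \<comment> \<open>Starting at \<open>b + 1\<close> instead of \<open>b\<close> keeps both layers
    of every cut inside the slab above \<open>b\<close>, and the index positive even for
    \<open>b = 0\<close>, as \<open>expectation_prod_R\<close> requires.\<close>
  define S where "S = (\<lambda>k. b + 1 + 2 * k) ` {..<(i - b - 1) div 2}"
  define A :: "nat \<Rightarrow> (nat \<times> 'h) set" where "A s = {s<..} \<times> UNIV" for s
  have S: "b < s" "s < i" if "s \<in> S" for s using that by (auto simp: S_def)
  have "\<bar>unpaired_prob x (slab_edges VH EH a c) (i, j) - unpaired_prob x (slab_edges VH EH b c) (i, j)\<bar>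
      \<le> (\<Prod>s\<in>S. 1 - (\<Prod>e\<in>cut_edges VH s. 1 / (1 + x e))\<^sup>2)"
  proof (rule unpaired_prob_diff_le[where A=A])
    show "slab_edges VH EH a c \<inter> Pow (A s) = slab_edges VH EH b c \<inter> Pow (A s)" if "s \<in> S" for s
    proof -
      have "slab VH a c \<inter> A s = slab VH b c \<inter> A s"
        using S[OF that] i by (auto simp: slab_def A_def)
      then show ?thesis by (auto simp: slab_edges_def)
    qed
    show "e \<subseteq> A s \<or> e \<inter> A s = {} \<or> e \<in> cut_edges VH s"
      if "e \<in> slab_edges VH EH a c \<union> slab_edges VH EH b c" for e s
    proof -
      from that consider i j where "j \<in> VH" "e = {(i, j), (i + 1, j)}" | i j j' where "e = {(i, j), (i, j')}"
        unfolding slab_edges_iff Un_iff by blast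
      then show ?thesis
      proof cases
        case (1 i j)
        then show ?thesis by (cases "i = s") (auto simp: A_def cut_edges_def)
      qed (auto simp: A_def)
    qed
    show "e \<subseteq> A t \<or> e \<inter> A t = {}" if "s \<noteq> t" "e \<in> cut_edges VH s" for e s t
      using that by (auto simp: A_def cut_edges_def)
    show "(i, j) \<in> A s" if "s \<in> S" for s using S[OF that] by (simp add: A_def)
  qed (use VH x in \<open>auto simp: S_def finite_slab_edges finite_cut_edges\<close>)
  also have "\<dots> = (\<Prod>k<(i - b - 1) div 2. block_prob VH x (b + 1 + 2 * k))"
    unfolding S_def block_prob_def by (subst prod.reindex) (auto simp: inj_on_def)
  finally show ?thesis .
qed

text \<open>Every vertex is compared with the slab on its own side of \<open>b\<close>. At distance
  \<open>m\<close> from the division there are \<open>m div 2\<close> factors, so for random weights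
  the mean decays geometrically in \<open>m\<close> and the sums stay bounded in the mean, however
  long the slabs are.\<close>

lemma slab_unpaired_almost_additive:
  fixes x :: "(nat \<times> 'h) set \<Rightarrow> real"
  assumes VH: "finite VH" and x: "\<And>e. 0 < x e" and ab: "a \<le> b" "b \<le> c"
  shows "\<bar>slab_unpaired VH EH x a c - slab_unpaired VH EH x a b - slab_unpaired VH EH x b c\<bar>
    \<le> card VH * ((\<Sum>m<b - a. \<Prod>k<m div 2. block_prob VH x (b - m + 2 * k)) +
                 (\<Sum>m<c - b. \<Prod>k<m div 2. block_prob VH x (b + 1 + 2 * k)))"
proof -
  let ?p = "\<lambda>a b. unpaired_prob x (slab_edges VH EH a b)"
  have un: "slab VH a c = slab VH a b \<union> slab VH b c" "slab VH a b \<inter> slab VH b c = {}"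
    using ab by (auto simp: slab_def)
  have "slab_unpaired VH EH x a c = sum (?p a c) (slab VH a b) + sum (?p a c) (slab VH b c)"
    unfolding slab_unpaired_def un(1) using un(2) VH
    by (intro sum.union_disjoint) (auto simp: finite_slab)
  then have "slab_unpaired VH EH x a c - slab_unpaired VH EH x a b - slab_unpaired VH EH x b c
      = (\<Sum>v\<in>slab VH a b. ?p a c v - ?p a b v) + (\<Sum>v\<in>slab VH b c. ?p a c v - ?p b c v)"
    by (simp add: slab_unpaired_def sum_subtractf)
  also have "\<bar>\<dots>\<bar> \<le> (\<Sum>v\<in>slab VH a b. \<bar>?p a c v - ?p a b v\<bar>) + (\<Sum>v\<in>slab VH b c. \<bar>?p a c v - ?p b c v\<bar>)"
    by (intro order.trans[OF abs_triangle_ineq] add_mono sum_abs)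
  also have "\<dots> \<le> (\<Sum>(i, j)\<in>slab VH a b. \<Prod>k<(b - i) div 2. block_prob VH x (i + 2 * k))
      + (\<Sum>(i, j)\<in>slab VH b c. \<Prod>k<(i - b - 1) div 2. block_prob VH x (b + 1 + 2 * k))"
  proof (intro add_mono sum_mono; clarify)
    show "\<bar>?p a c (i, j) - ?p a b (i, j)\<bar> \<le> (\<Prod>k<(b - i) div 2. block_prob VH x (i + 2 * k))"
      if "(i, j) \<in> slab VH a b" for i j
      using that ab by (intro unpaired_prob_cut_right VH x) (auto simp: slab_def)
    show "\<bar>?p a c (i, j) - ?p b c (i, j)\<bar> \<le> (\<Prod>k<(i - b - 1) div 2. block_prob VH x (b + 1 + 2 * k))"
      if "(i, j) \<in> slab VH b c" for i j
      using that ab by (intro unpaired_prob_cut_left VH x) (auto simp: slab_def)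
  qed
  also have "(\<Sum>(i, j)\<in>slab VH a b. \<Prod>k<(b - i) div 2. block_prob VH x (i + 2 * k))
      = card VH * (\<Sum>i\<in>{a<..b}. \<Prod>k<(b - i) div 2. block_prob VH x (i + 2 * k))"
    by (simp add: slab_def sum.cartesian_product[symmetric] sum_distrib_left)
  also have "(\<Sum>i\<in>{a<..b}. \<Prod>k<(b - i) div 2. block_prob VH x (i + 2 * k))
      = (\<Sum>m<b - a. \<Prod>k<m div 2. block_prob VH x (b - m + 2 * k))"
    by (rule sum.reindex_bij_witness[of _ "\<lambda>m. b - m" "\<lambda>i. b - i"]) auto
  also have "(\<Sum>(i, j)\<in>slab VH b c. \<Prod>k<(i - b - 1) div 2. block_prob VH x (b + 1 + 2 * k))
      = card VH * (\<Sum>i\<in>{b<..c}. \<Prod>k<(i - b - 1) div 2. block_prob VH x (b + 1 + 2 * k))"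
    by (simp add: slab_def sum.cartesian_product[symmetric] sum_distrib_left)
  also have "(\<Sum>i\<in>{b<..c}. \<Prod>k<(i - b - 1) div 2. block_prob VH x (b + 1 + 2 * k))
      = (\<Sum>m<c - b. \<Prod>k<m div 2. block_prob VH x (b + 1 + 2 * k))"
    by (rule sum.reindex_bij_witness[of _ "\<lambda>m. m + b + 1" "\<lambda>i. i - b - 1"]) auto
  finally show ?thesis by (simp add: algebra_simps)
qed

section \<open>Relabelling of vertices and shifts of layers\<close>

lemma unpaired_prob_image:
  assumes f: "inj f"
  shows "unpaired_prob x (image f ` E) (f v) = unpaired_prob (\<lambda>e. x (f ` e)) E v"
proof -
  have inj: "inj (image f)" "inj (image (image f))"
    using f by (simp_all add: inj_image_eq_iff inj_def)
  have dj: "disjoint (image f ` m) \<longleftrightarrow> disjoint m" for m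
    unfolding disjoint_def using f by (simp add: inj_image_eq_iff image_Int[OF f, symmetric])
  have M: "matchings (image f ` E) = image (image f) ` matchings E"
  proof (intro equalityI subsetI)
    fix m assume m: "m \<in> matchings (image f ` E)"
    then obtain m0 where m0: "m0 \<subseteq> E" "m = image f ` m0"
      unfolding matchings_def by (auto simp: subset_image_iff)
    then have "m0 \<in> matchings E"
      using m by (simp add: matchings_def dj)
    then show "m \<in> image (image f) ` matchings E" using m0 by blast
  next
    fix m assume "m \<in> image (image f) ` matchings E"
    then show "m \<in> matchings (image f ` E)"
      by (auto simp: matchings_def dj)
  qed
  have P: "prod x (image f ` m) = prod (\<lambda>e. x (f ` e)) m" for m
    using inj(1) by (subst prod.reindex) (auto intro: inj_on_subset)
  have N: "{m \<in> image (image f) ` matchings E. f v \<notin> \<Union>m} = image (image f) ` {m \<in> matchings E. v \<notin> \<Union>m}"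
  proof -
    have "f v \<notin> \<Union>(image f ` m) \<longleftrightarrow> v \<notin> \<Union>m" for m
      using f by (auto simp: inj_image_mem_iff)
    then show ?thesis by blast
  qed
  show ?thesis
    unfolding unpaired_prob_def M N
    by (subst (1 2) sum.reindex) (use inj(2) P in \<open>auto intro: inj_on_subset\<close>)
qed

lemma inj_layer_shift: "inj (layer_shift a)"
  by (auto simp: layer_shift_def inj_def)

lemma activity_image:
  assumes "inj f"
  shows "activity \<nu> \<omega> (f ` e) = activity (\<lambda>v. \<nu> (f v)) (\<lambda>e. \<omega> (f ` e)) e"
  using assms by (simp add: activity_def sum.reindex inj_on_subset[OF assms])

lemma slab_shift: "slab VH a (a + n) = layer_shift a ` slab VH 0 n"
proof (intro equalityI subsetI)
  fix v assume "v \<in> slab VH a (a + n)"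
  then show "v \<in> layer_shift a ` slab VH 0 n"
    by (intro image_eqI[of _ _ "(fst v - a, snd v)"]) (auto simp: slab_def layer_shift_def)
qed (auto simp: slab_def layer_shift_def)

lemma slab_edges_shift: "slab_edges VH EH a (a + n) = image (layer_shift a) ` slab_edges VH EH 0 n"
proof (intro equalityI subsetI)
  fix e assume "e \<in> slab_edges VH EH a (a + n)"
  then consider i j where "a < i" "i + 1 \<le> a + n" "j \<in> VH" "e = {(i, j), (i + 1, j)}"
    | i j j' where "a < i" "i \<le> a + n" "j \<in> VH" "j' \<in> VH" "{j, j'} \<in> EH" "e = {(i, j), (i, j')}"
    unfolding slab_edges_iff by blast
  then show "e \<in> image (layer_shift a) ` slab_edges VH EH 0 n"
  proof cases
    case (1 i j)
    then have "e = layer_shift a ` {(i - a, j), (i - a + 1, j)}" by (auto simp: layer_shift_def)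
    moreover have "{(i - a, j), (i - a + 1, j)} \<in> slab_edges VH EH 0 n"
      unfolding slab_edges_iff using 1 by (intro disjI1 exI[of _ "i - a"] exI[of _ j]) auto
    ultimately show ?thesis by blast
  next
    case (2 i j j')
    then have "e = layer_shift a ` {(i - a, j), (i - a, j')}" by (auto simp: layer_shift_def)
    moreover have "{(i - a, j), (i - a, j')} \<in> slab_edges VH EH 0 n"
      unfolding slab_edges_iff using 2
      by (intro disjI2 exI[of _ "i - a"] exI[of _ j] exI[of _ j']) auto
    ultimately show ?thesis by blast
  qed
next
  fix e assume "e \<in> image (layer_shift a) ` slab_edges VH EH 0 n"
  then obtain e0 where e: "e = layer_shift a ` e0" "e0 \<in> slab_edges VH EH 0 n" by blast
  from e(2) consider i j where "0 < i" "i + 1 \<le> n" "j \<in> VH" "e0 = {(i, j), (i + 1, j)}"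
    | i j j' where "0 < i" "i \<le> n" "j \<in> VH" "j' \<in> VH" "{j, j'} \<in> EH" "e0 = {(i, j), (i, j')}"
    unfolding slab_edges_iff by blast
  then show "e \<in> slab_edges VH EH a (a + n)"
  proof cases
    case (1 i j)
    then show ?thesis unfolding slab_edges_iff e(1)
      by (intro disjI1 exI[of _ "i + a"] exI[of _ j]) (auto simp: layer_shift_def)
  next
    case (2 i j j')
    then show ?thesis unfolding slab_edges_iff e(1)
      by (intro disjI2 exI[of _ "i + a"] exI[of _ j] exI[of _ j']) (auto simp: layer_shift_def)
  qed
qed

lemma slab_unpaired_shift:
  "slab_unpaired VH EH x a (a + n) = slab_unpaired VH EH (\<lambda>e. x (layer_shift a ` e)) 0 n"
  unfolding slab_unpaired_def slab_shift slab_edges_shift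
  by (subst sum.reindex) (auto intro: inj_on_subset[OF inj_layer_shift] simp: unpaired_prob_image[OF inj_layer_shift])

lemma cut_edges_shift: "cut_edges VH (s + a) = image (layer_shift a) ` cut_edges VH s"
  by (auto simp: cut_edges_def layer_shift_def image_image)

lemma block_prob_shift: "block_prob VH x (s + a) = block_prob VH (\<lambda>e. x (layer_shift a ` e)) s"
proof -
  have "inj (image (layer_shift a))"
    unfolding inj_def by (simp add: inj_image_eq_iff[OF inj_layer_shift])
  then show ?thesis
    unfolding block_prob_def cut_edges_shift
    by (subst prod.reindex) (auto intro: inj_on_subset)
qed

lemma unpaired_prob_cong:
  assumes "\<And>e. e \<in> E \<Longrightarrow> x e = y e"
  shows "unpaired_prob x E v = unpaired_prob y E v"
proof -
  have "prod x m = prod y m" if "m \<in> matchings E" for m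
    using that assms by (intro prod.cong) (auto simp: matchings_def)
  then show ?thesis unfolding unpaired_prob_def by (auto intro!: arg_cong2[where f="(/)"] sum.cong)
qed

lemma slab_unpaired_cong:
  assumes "\<And>e. e \<in> slab_edges VH EH a b \<Longrightarrow> x e = y e"
  shows "slab_unpaired VH EH x a b = slab_unpaired VH EH y a b"
  unfolding slab_unpaired_def using assms by (intro sum.cong refl unpaired_prob_cong)

section \<open>The central limit theorem for almost additive processes\<close>

context prob_space
begin

text \<open>A purely qualitative bound: it makes every polynomial in such variables integrable,
  while all estimates come from moments.\<close>

definition bounded_rv :: "('a \<Rightarrow> real) \<Rightarrow> bool" where
  "bounded_rv f \<longleftrightarrow> f \<in> borel_measurable M \<and> (\<exists>B. \<forall>x\<in>space M. \<bar>f x\<bar> \<le> B)"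

lemma bounded_rv_measurable: "bounded_rv f \<Longrightarrow> f \<in> borel_measurable M"
  by (simp add: bounded_rv_def)

lemma bounded_rv_integrable: "bounded_rv f \<Longrightarrow> integrable M f"
  unfolding bounded_rv_def by (auto intro!: integrable_const_bound AE_I2)

lemma bounded_rv_const [intro!]: "bounded_rv (\<lambda>_. c)"
  by (auto simp: bounded_rv_def)

lemma bounded_rv_mult [intro!]:
  assumes "bounded_rv f" "bounded_rv g"
  shows "bounded_rv (\<lambda>x. f x * g x)"
proof -
  obtain A B where "\<And>x. x \<in> space M \<Longrightarrow> \<bar>f x\<bar> \<le> A" "\<And>x. x \<in> space M \<Longrightarrow> \<bar>g x\<bar> \<le> B"
    using assms by (auto simp: bounded_rv_def)
  then have "\<bar>f x * g x\<bar> \<le> A * B" if "x \<in> space M" for x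
    using that by (auto simp: abs_mult intro!: mult_mono order_trans[OF abs_ge_zero])
  then show ?thesis using assms by (auto simp: bounded_rv_def)
qed

lemma bounded_rv_add [intro!]:
  assumes "bounded_rv f" "bounded_rv g"
  shows "bounded_rv (\<lambda>x. f x + g x)"
proof -
  obtain A B where "\<And>x. x \<in> space M \<Longrightarrow> \<bar>f x\<bar> \<le> A" "\<And>x. x \<in> space M \<Longrightarrow> \<bar>g x\<bar> \<le> B"
    using assms by (auto simp: bounded_rv_def)
  then have "\<bar>f x + g x\<bar> \<le> A + B" if "x \<in> space M" for x
    using that by (auto intro!: order_trans[OF abs_triangle_ineq] add_mono)
  then show ?thesis using assms by (auto simp: bounded_rv_def)
qed

lemma bounded_rv_diff [intro!]: "bounded_rv f \<Longrightarrow> bounded_rv g \<Longrightarrow> bounded_rv (\<lambda>x. f x - g x)"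
  using bounded_rv_add[of f "\<lambda>x. - 1 * g x"] bounded_rv_mult[of "\<lambda>_. - 1" g] by auto

lemma bounded_rv_divide [intro!]: "bounded_rv f \<Longrightarrow> bounded_rv (\<lambda>x. f x / c)"
  using bounded_rv_mult[of f "\<lambda>_. 1 / c"] by auto

lemma bounded_rv_power [intro!]: "bounded_rv f \<Longrightarrow> bounded_rv (\<lambda>x. f x ^ n)"
  by (induction n) auto

lemma bounded_rv_abs [intro!]: "bounded_rv f \<Longrightarrow> bounded_rv (\<lambda>x. \<bar>f x\<bar>)"
  by (auto simp: bounded_rv_def)

lemma bounded_rv_sum [intro!]: "(\<And>i. i \<in> I \<Longrightarrow> bounded_rv (f i)) \<Longrightarrow> bounded_rv (\<lambda>x. \<Sum>i\<in>I. f i x)"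
  by (induction I rule: infinite_finite_induct) auto

lemma expectation_mono:
  assumes "bounded_rv f" "bounded_rv g" "\<And>x. x \<in> space M \<Longrightarrow> f x \<le> g x"
  shows "expectation f \<le> expectation g"
  using assms by (intro integral_mono bounded_rv_integrable)

definition L2norm :: "('a \<Rightarrow> real) \<Rightarrow> real" where
  "L2norm f = sqrt (expectation (\<lambda>x. (f x)\<^sup>2))"

lemma L2norm_nonneg: "0 \<le> L2norm f"
  by (simp add: L2norm_def)

lemma L2norm_power2: "(L2norm f)\<^sup>2 = expectation (\<lambda>x. (f x)\<^sup>2)"
  by (simp add: L2norm_def)

text \<open>Cauchy-Schwarz from a weighted inequality between arithmetic and geometric mean. The
  weights divide by the two norms, which may vanish; hence the shift by \<open>\<delta>\<close>,
  removed by a limit at the end.\<close>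

lemma expectation_mult_le_L2norm:
  assumes "bounded_rv f" "bounded_rv g"
  shows "expectation (\<lambda>x. f x * g x) \<le> L2norm f * L2norm g"
proof -
  let ?a = "L2norm f" and ?b = "L2norm g"
  have le: "expectation (\<lambda>x. f x * g x) \<le> (?a + \<delta>) * (?b + \<delta>)" if "\<delta> > 0" for \<delta>
  proof -
    have pos: "0 < ?a + \<delta>" "0 < ?b + \<delta>" using that L2norm_nonneg by (auto intro: add_nonneg_pos)
    have "f x * g x \<le> (?b + \<delta>) / (2 * (?a + \<delta>)) * (f x)\<^sup>2 + (?a + \<delta>) / (2 * (?b + \<delta>)) * (g x)\<^sup>2" for x
    proof -
      have "0 \<le> ((?b + \<delta>) * f x - (?a + \<delta>) * g x)\<^sup>2 / (2 * (?a + \<delta>) * (?b + \<delta>))"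
        using pos by simp
      also have "\<dots> = (?b + \<delta>) / (2 * (?a + \<delta>)) * (f x)\<^sup>2 + (?a + \<delta>) / (2 * (?b + \<delta>)) * (g x)\<^sup>2 - f x * g x"
        using pos by (simp add: power2_diff power_mult_distrib divide_simps) (simp add: power2_eq_square algebra_simps)
      finally show ?thesis by simp
    qed
    then have "expectation (\<lambda>x. f x * g x)
        \<le> expectation (\<lambda>x. (?b + \<delta>) / (2 * (?a + \<delta>)) * (f x)\<^sup>2 + (?a + \<delta>) / (2 * (?b + \<delta>)) * (g x)\<^sup>2)"
      using assms by (intro expectation_mono) auto
    also have "\<dots> = (?b + \<delta>) / (2 * (?a + \<delta>)) * ?a\<^sup>2 + (?a + \<delta>) / (2 * (?b + \<delta>)) * ?b\<^sup>2"
      unfolding L2norm_power2 using assms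
      by (subst Bochner_Integration.integral_add) (auto intro!: bounded_rv_integrable simp del: times_divide_eq_left)
    also have "\<dots> \<le> (?b + \<delta>) / (2 * (?a + \<delta>)) * (?a + \<delta>)\<^sup>2 + (?a + \<delta>) / (2 * (?b + \<delta>)) * (?b + \<delta>)\<^sup>2"
      using pos that L2norm_nonneg by (intro add_mono mult_left_mono power_mono) auto
    also have "\<dots> = (?a + \<delta>) * (?b + \<delta>)"
    proof -
      have "B / (2 * A) * A\<^sup>2 + A / (2 * B) * B\<^sup>2 = A * B" if "0 < A" "0 < B" for A B :: real
        using that by (simp add: power2_eq_square)
      from this[OF pos] show ?thesis .
    qed
    finally show ?thesis .
  qed
  have "((\<lambda>\<delta>. (?a + \<delta>) * (?b + \<delta>)) \<longlongrightarrow> (?a + 0) * (?b + 0)) (at_right 0)"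
    by (intro tendsto_intros)
  then have "expectation (\<lambda>x. f x * g x) \<le> (?a + 0) * (?b + 0)"
    by (rule tendsto_lowerbound) (auto simp: eventually_at_right_field intro!: exI[of _ 1] le)
  then show ?thesis by simp
qed

lemma L2norm_triangle:
  assumes "bounded_rv f" "bounded_rv g"
  shows "L2norm (\<lambda>x. f x + g x) \<le> L2norm f + L2norm g"
proof (rule power2_le_imp_le)
  have "(L2norm (\<lambda>x. f x + g x))\<^sup>2 = expectation (\<lambda>x. (f x)\<^sup>2 + (g x)\<^sup>2 + 2 * (f x * g x))"
    unfolding L2norm_power2 by (simp add: power2_sum mult.assoc)
  also have "\<dots> = (L2norm f)\<^sup>2 + (L2norm g)\<^sup>2 + 2 * expectation (\<lambda>x. f x * g x)"
    unfolding L2norm_power2 using assms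
    by (subst Bochner_Integration.integral_add, (auto intro!: bounded_rv_integrable)[2])+ auto
  also have "\<dots> \<le> (L2norm f + L2norm g)\<^sup>2"
    using expectation_mult_le_L2norm[OF assms] by (simp add: power2_sum)
  finally show "(L2norm (\<lambda>x. f x + g x))\<^sup>2 \<le> (L2norm f + L2norm g)\<^sup>2" .
qed (simp add: L2norm_nonneg)

lemma L2norm_diff_triangle:
  assumes "bounded_rv f" "bounded_rv g"
  shows "\<bar>L2norm f - L2norm g\<bar> \<le> L2norm (\<lambda>x. f x - g x)"
proof -
  have "L2norm f \<le> L2norm (\<lambda>x. f x - g x) + L2norm g"
    using L2norm_triangle[of "\<lambda>x. f x - g x" g] assms by auto
  moreover have "L2norm g \<le> L2norm (\<lambda>x. g x - f x) + L2norm f"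
    using L2norm_triangle[of "\<lambda>x. g x - f x" f] assms by auto
  moreover have "L2norm (\<lambda>x. g x - f x) = L2norm (\<lambda>x. f x - g x)"
    by (simp add: L2norm_def power2_commute)
  ultimately show ?thesis by linarith
qed

lemma expectation_abs_le_L2norm:
  assumes "bounded_rv f"
  shows "expectation (\<lambda>x. \<bar>f x\<bar>) \<le> L2norm f"
  using expectation_mult_le_L2norm[of "\<lambda>x. \<bar>f x\<bar>" "\<lambda>_. 1"] assms
  by (auto simp: L2norm_def prob_space)

lemma expectation_power2_le:
  assumes "bounded_rv f"
  shows "(expectation f)\<^sup>2 \<le> expectation (\<lambda>x. (f x)\<^sup>2)"
  using variance_positive[of f] assms
  by (subst (asm) variance_eq) (auto intro!: bounded_rv_integrable)

lemma expectation_power4_le: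
  assumes "bounded_rv f"
  shows "(expectation f) ^ 4 \<le> expectation (\<lambda>x. f x ^ 4)"
proof -
  have "((expectation f)\<^sup>2)\<^sup>2 \<le> (expectation (\<lambda>x. (f x)\<^sup>2))\<^sup>2"
    using expectation_power2_le[OF assms] by (intro power_mono) auto
  also have "\<dots> \<le> expectation (\<lambda>x. ((f x)\<^sup>2)\<^sup>2)"
    using assms by (intro expectation_power2_le) auto
  finally show ?thesis by simp
qed

lemma expectation_indep_mult:
  assumes "indep_var borel X borel Y" "bounded_rv X" "bounded_rv Y"
  shows "expectation (\<lambda>x. X x ^ p * Y x ^ q) = expectation (\<lambda>x. X x ^ p) * expectation (\<lambda>x. Y x ^ q)"
  using assms
  by (intro indep_var_lebesgue_integral bounded_rv_integrable)
     (auto intro!: indep_var_compose[unfolded comp_def, OF assms(1)])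

lemma expectation_power2_add:
  assumes "indep_var borel X borel Y" "bounded_rv X" "bounded_rv Y" "expectation X = 0"
  shows "expectation (\<lambda>x. (X x + Y x)\<^sup>2) = expectation (\<lambda>x. (X x)\<^sup>2) + expectation (\<lambda>x. (Y x)\<^sup>2)"
proof -
  have "expectation (\<lambda>x. (X x + Y x)\<^sup>2) = expectation (\<lambda>x. ((X x)\<^sup>2 + (Y x)\<^sup>2) + 2 * (X x * Y x))"
    by (simp add: power2_sum mult.assoc)
  also have "\<dots> = expectation (\<lambda>x. (X x)\<^sup>2) + expectation (\<lambda>x. (Y x)\<^sup>2) + 2 * expectation (\<lambda>x. X x * Y x)"
    using assms by (subst Bochner_Integration.integral_add, (auto intro!: bounded_rv_integrable)[2])+ auto
  also have "expectation (\<lambda>x. X x * Y x) = 0"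
    using expectation_indep_mult[OF assms(1-3), of 1 1] assms(4) by simp
  finally show ?thesis by simp
qed

text \<open>In each mixed term of type \<open>(3, 1)\<close> one factor is centred, so by
  independence only the squares interact.\<close>

lemma expectation_power4_add:
  assumes "indep_var borel X borel Y" "bounded_rv X" "bounded_rv Y" "expectation X = 0" "expectation Y = 0"
  shows "expectation (\<lambda>x. (X x + Y x) ^ 4) = expectation (\<lambda>x. X x ^ 4) + expectation (\<lambda>x. Y x ^ 4)
     + 6 * (expectation (\<lambda>x. (X x)\<^sup>2) * expectation (\<lambda>x. (Y x)\<^sup>2))"
proof -
  have "expectation (\<lambda>x. (X x + Y x) ^ 4) = expectation (\<lambda>x. (X x ^ 4 + Y x ^ 4) +
      (6 * ((X x)\<^sup>2 * (Y x)\<^sup>2) + (4 * (X x ^ 3 * Y x ^ 1) + 4 * (X x ^ 1 * Y x ^ 3))))"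
    by (rule Bochner_Integration.integral_cong) (auto simp: power4_eq_xxxx power3_eq_cube power2_eq_square algebra_simps)
  also have "\<dots> = (expectation (\<lambda>x. X x ^ 4) + expectation (\<lambda>x. Y x ^ 4)) +
      (6 * expectation (\<lambda>x. (X x)\<^sup>2 * (Y x)\<^sup>2) +
      (4 * expectation (\<lambda>x. X x ^ 3 * Y x ^ 1) + 4 * expectation (\<lambda>x. X x ^ 1 * Y x ^ 3)))"
    using assms by (subst Bochner_Integration.integral_add, (auto intro!: bounded_rv_integrable)[2])+ auto
  also have "\<dots> = expectation (\<lambda>x. X x ^ 4) + expectation (\<lambda>x. Y x ^ 4)
     + 6 * (expectation (\<lambda>x. (X x)\<^sup>2) * expectation (\<lambda>x. (Y x)\<^sup>2))"
    unfolding expectation_indep_mult[OF assms(1-3)] using assms(4,5) by simp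
  finally show ?thesis .
qed

section \<open>Characteristic functions and elementary inequalities\<close>

lemma char_diff_le:
  assumes "bounded_rv f" "bounded_rv g"
  shows "cmod (char (distr M borel f) t - char (distr M borel g) t)
    \<le> \<bar>t\<bar> * expectation (\<lambda>x. \<bar>f x - g x\<bar>)"
proof -
  note [measurable] = assms[THEN bounded_rv_measurable]
  have int: "integrable M (\<lambda>x. iexp (t * f x))" "integrable M (\<lambda>x. iexp (t * g x))"
    using assms by (auto intro!: integrable_iexp)
  have "char (distr M borel f) t - char (distr M borel g) t = (CLINT x|M. iexp (t * f x) - iexp (t * g x))"
    unfolding char_def using int by (simp add: integral_distr)
  also have "cmod \<dots> \<le> expectation (\<lambda>x. cmod (iexp (t * f x) - iexp (t * g x)))"
    by (rule integral_norm_bound)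
  also have "\<dots> \<le> expectation (\<lambda>x. \<bar>t\<bar> * \<bar>f x - g x\<bar>)"
  proof (rule integral_mono)
    show "integrable M (\<lambda>x. cmod (iexp (t * f x) - iexp (t * g x)))"
      using int by auto
    show "integrable M (\<lambda>x. \<bar>t\<bar> * \<bar>f x - g x\<bar>)"
      using assms by (intro bounded_rv_integrable) auto
    fix x
    have "iexp (t * f x) - iexp (t * g x) = iexp (t * g x) * (iexp (t * (f x - g x)) - 1)"
      by (simp add: exp_add[symmetric] algebra_simps)
    then have "cmod (iexp (t * f x) - iexp (t * g x)) = cmod (iexp (t * (f x - g x)) - 1)"
      by (simp add: norm_mult)
    also have "\<dots> \<le> \<bar>t * (f x - g x)\<bar>"
      using iexp_approx1[of "t * (f x - g x)" 0] by simp
    finally show "cmod (iexp (t * f x) - iexp (t * g x)) \<le> \<bar>t\<bar> * \<bar>f x - g x\<bar>"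
      by (simp add: abs_mult)
  qed
  finally show ?thesis by simp
qed

end

lemma real_distribution_centered_normal:
  assumes "0 \<le> s2"
  shows "real_distribution (centered_normal s2)"
proof (cases "s2 = 0")
  case True
  then show ?thesis
    by (auto simp: centered_normal_def real_distribution_def real_distribution_axioms_def
        intro!: prob_space_return)
next
  case False
  then show ?thesis using assms
    by (auto simp: centered_normal_def real_distribution_def real_distribution_axioms_def
        intro!: prob_space_normal_density)
qed

lemma char_centered_normal:
  assumes "0 \<le> s2"
  shows "char (centered_normal s2) t = exp (- (s2 * t\<^sup>2 / 2))"
proof (cases "s2 = 0")
  case True
  then show ?thesis by (simp add: centered_normal_def char_def integral_return)
next
  case False
  then have s: "0 < s2" using assms by simp
  interpret N: prob_space std_normal_distribution
    by (rule prob_space_normal_density) simp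
  have "distributed std_normal_distribution lborel (\<lambda>x. x) std_normal_density"
    by (auto simp: distributed_def distr_id2)
  then have "distributed std_normal_distribution lborel (\<lambda>x. 0 + sqrt s2 * x) (normal_density (0 + sqrt s2 * 0) (\<bar>sqrt s2\<bar> * 1))"
    by (intro N.normal_density_affine) (use s in auto)
  then have "density lborel (\<lambda>x. ennreal (normal_density 0 (sqrt s2) x)) = distr std_normal_distribution lborel (\<lambda>x. sqrt s2 * x)"
    using s by (simp add: distributed_def)
  then have "centered_normal s2 = distr std_normal_distribution lborel (\<lambda>x. sqrt s2 * x)"
    using s by (simp add: centered_normal_def)
  then have "char (centered_normal s2) t = char std_normal_distribution (t * sqrt s2)"
    unfolding char_def by (simp add: integral_distr mult.assoc)
  then show ?thesis
    using s by (simp add: char_std_normal_distribution power_mult_distrib mult.commute exp_of_real)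
qed

text \<open>The upper bound rests on \<open>(1 - \<theta> + \<theta>\<^sup>2) * (1 + \<theta>) = 1 +
  \<theta> ^ 3\<close> and \<open>1 + \<theta> \<le> exp \<theta>\<close>.\<close>

lemma exp_minus_approx:
  fixes \<theta> :: real
  assumes "0 \<le> \<theta>"
  shows "\<bar>exp (- \<theta>) - (1 - \<theta>)\<bar> \<le> \<theta>\<^sup>2"
proof -
  have "1 - \<theta> \<le> exp (- \<theta>)" using exp_ge_add_one_self[of "- \<theta>"] by simp
  moreover have "exp (- \<theta>) \<le> 1 - \<theta> + \<theta>\<^sup>2"
  proof -
    have "1 \<le> (1 - \<theta> + \<theta>\<^sup>2) * (1 + \<theta>)"
      using assms by (simp add: algebra_simps power2_eq_square)
    also have "\<dots> \<le> (1 - \<theta> + \<theta>\<^sup>2) * exp \<theta>"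
    proof (rule mult_left_mono[OF exp_ge_add_one_self])
      have "0 \<le> (1 - \<theta>)\<^sup>2 + \<theta>" using assms by simp
      then show "0 \<le> 1 - \<theta> + \<theta>\<^sup>2" by (simp add: power2_diff)
    qed
    finally show ?thesis by (simp add: exp_minus divide_simps)
  qed
  ultimately show ?thesis by simp
qed

lemma power4_add_le: "(x + y) ^ 4 \<le> 8 * (x ^ 4 + y ^ 4)" for x y :: real
proof -
  have "((x + y)\<^sup>2)\<^sup>2 \<le> (2 * x\<^sup>2 + 2 * y\<^sup>2)\<^sup>2"
    using zero_le_power2[of "x - y"]
    by (intro power_mono zero_le_power2) (simp add: power2_sum power2_diff)
  also have "\<dots> \<le> 2 * (2 * x\<^sup>2)\<^sup>2 + 2 * (2 * y\<^sup>2)\<^sup>2"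
    using zero_le_power2[of "2 * x\<^sup>2 - 2 * y\<^sup>2"] by (simp add: power2_sum power2_diff)
  finally show ?thesis by (simp add: power_mult_distrib power_mult[symmetric])
qed

section \<open>Moments of an almost additive process\<close>

locale almost_additive_process = prob_space +
  fixes F :: "nat \<Rightarrow> nat \<Rightarrow> 'a \<Rightarrow> real" and C :: real
  assumes bounded: "bounded_rv (F a b)"
    and stationary: "distr M borel (F a (a + n)) = distr M borel (F 0 n)"
    and indep: "mono t \<Longrightarrow> indep_vars (\<lambda>_. borel) (\<lambda>i. F (t i) (t (i + 1))) (UNIV :: nat set)"
    and almost_additive: "a \<le> b \<Longrightarrow> b \<le> c \<Longrightarrow>
      expectation (\<lambda>x. (F a c x - F a b x - F b c x) ^ 4) \<le> C"
begin

text \<open>By stationarity, the constant is the mean of \<open>F a b\<close> whenever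
  \<open>a \<le> b\<close>. Written with \<open>b - a\<close>, it is visibly the same for all blocks
  of equal length.\<close>

definition G :: "nat \<Rightarrow> nat \<Rightarrow> 'a \<Rightarrow> real" where
  "G a b x = F a b x - expectation (F 0 (b - a))"

definition D :: "nat \<Rightarrow> nat \<Rightarrow> nat \<Rightarrow> 'a \<Rightarrow> real" where
  "D a b c x = G a c x - G a b x - G b c x"

definition v :: "nat \<Rightarrow> real" where
  "v n = expectation (\<lambda>x. (G 0 n x)\<^sup>2)"

definition m4 :: "nat \<Rightarrow> real" where
  "m4 n = expectation (\<lambda>x. G 0 n x ^ 4)"

text \<open>L2 bound for the defect: \<open>y\<^sup>2 \<le> 1 + y ^ 4\<close> turns the
  fourth-moment bound into \<open>1 + C\<close>, and centring only lowers a second moment.\<close>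

definition d :: real where
  "d = sqrt (1 + C)"

lemma bounded_G [intro!]: "bounded_rv (G a b)"
  unfolding G_def using bounded by auto

lemma bounded_D [intro!]: "bounded_rv (D a b c)"
  unfolding D_def by auto

lemma F_measurable [measurable]: "F a b \<in> borel_measurable M"
  using bounded by (rule bounded_rv_measurable)

lemma G_measurable [measurable]: "G a b \<in> borel_measurable M"
  using bounded_G by (rule bounded_rv_measurable)

lemma expectation_stationary:
  fixes f :: "real \<Rightarrow> real"
  assumes [measurable]: "f \<in> borel_measurable borel" and "a \<le> b"
  shows "expectation (\<lambda>x. f (F a b x)) = expectation (\<lambda>x. f (F 0 (b - a) x))"
proof -
  have "expectation (\<lambda>x. f (F a b x)) = integral\<^sup>L (distr M borel (F a (a + (b - a)))) f"
    using \<open>a \<le> b\<close> by (simp add: integral_distr)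
  also have "\<dots> = expectation (\<lambda>x. f (F 0 (b - a) x))"
    by (simp only: stationary) (simp add: integral_distr)
  finally show ?thesis .
qed

lemma expectation_G_stationary:
  fixes f :: "real \<Rightarrow> real"
  assumes [measurable]: "f \<in> borel_measurable borel" and "a \<le> b"
  shows "expectation (\<lambda>x. f (G a b x)) = expectation (\<lambda>x. f (G 0 (b - a) x))"
  unfolding G_def using expectation_stationary[of "\<lambda>y. f (y - expectation (F 0 (b - a)))" a b] assms(2)
  by simp

lemma expectation_G: "a \<le> b \<Longrightarrow> expectation (G a b) = 0"
  using expectation_G_stationary[of "\<lambda>x. x" a b] bounded
  by (simp add: G_def[abs_def] prob_space bounded_rv_integrable)

lemma L2norm_G: "a \<le> b \<Longrightarrow> L2norm (G a b) = sqrt (v (b - a))"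
  using expectation_G_stationary[of "\<lambda>x. x\<^sup>2" a b] by (simp add: L2norm_def v_def)

lemma v_nonneg: "0 \<le> v n"
  by (simp add: v_def)

lemma C_nonneg: "0 \<le> C"
  using almost_additive[of 0 0 0] by (rule order_trans[rotated]) (auto intro!: integral_nonneg_AE)

lemma D_eq: "a \<le> b \<Longrightarrow> b \<le> c \<Longrightarrow>
   D a b c x = (F a c x - F a b x - F b c x) - expectation (\<lambda>x. F a c x - F a b x - F b c x)"
proof -
  assume ab: "a \<le> b" "b \<le> c"
  have "expectation (\<lambda>x. F a c x - F a b x - F b c x) = expectation (F a c) - expectation (F a b) - expectation (F b c)"
    using bounded by (simp add: bounded_rv_integrable)
  then show ?thesis
    using ab expectation_stationary[of "\<lambda>x. x" a c] expectation_stationary[of "\<lambda>x. x" a b]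
      expectation_stationary[of "\<lambda>x. x" b c] by (simp add: D_def G_def)
qed

lemma L2norm_D:
  assumes "a \<le> b" "b \<le> c"
  shows "L2norm (D a b c) \<le> d"
proof -
  let ?D = "\<lambda>x. F a c x - F a b x - F b c x"
  have bD: "bounded_rv ?D" using bounded by auto
  have "expectation (\<lambda>x. (D a b c x)\<^sup>2) = variance ?D"
    using D_eq[OF assms] by simp
  also have "\<dots> = expectation (\<lambda>x. (?D x)\<^sup>2) - (expectation ?D)\<^sup>2"
    using bD by (intro variance_eq bounded_rv_integrable) auto
  also have "\<dots> \<le> expectation (\<lambda>x. (?D x)\<^sup>2)"
    by simp
  also have "\<dots> \<le> expectation (\<lambda>x. 1 + ?D x ^ 4)"
  proof (rule expectation_mono)
    show "y\<^sup>2 \<le> 1 + y ^ 4" for y :: real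
    proof -
      have "2 * y\<^sup>2 \<le> y ^ 4 + 1"
        using zero_le_power2[of "y\<^sup>2 - 1"] by (simp add: power2_diff power_mult[symmetric])
      then show ?thesis using zero_le_power2[of y] by linarith
    qed
  qed (use bD in auto)
  also have "\<dots> = 1 + expectation (\<lambda>x. ?D x ^ 4)"
    using bD by (subst Bochner_Integration.integral_add) (auto intro!: bounded_rv_integrable simp: prob_space)
  also have "\<dots> \<le> 1 + C"
    using almost_additive[OF assms] by simp
  finally show ?thesis by (simp add: L2norm_def d_def)
qed

text \<open>\<open>D\<close> is the defect of \<open>F\<close> minus its mean. The fourth power of a
  difference costs a factor 8 on either term, and by Jensen the mean contributes no more than the
  defect itself; hence 16.\<close>

lemma expectation_D_power4:
  assumes "a \<le> b" "b \<le> c"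
  shows "expectation (\<lambda>x. D a b c x ^ 4) \<le> 16 * C"
proof -
  let ?D = "\<lambda>x. F a c x - F a b x - F b c x"
  have bD: "bounded_rv ?D" using bounded by auto
  have "expectation (\<lambda>x. D a b c x ^ 4) \<le> expectation (\<lambda>x. 8 * ?D x ^ 4 + 8 * expectation ?D ^ 4)"
  proof (rule expectation_mono)
    fix x
    have "(p - q) ^ 4 \<le> 8 * p ^ 4 + 8 * q ^ 4" for p q :: real
      using power4_add_le[of p "- q"] by simp
    then show "D a b c x ^ 4 \<le> 8 * ?D x ^ 4 + 8 * expectation ?D ^ 4"
      unfolding D_eq[OF assms] by blast
  qed (use bD in auto)
  also have "\<dots> = 8 * expectation (\<lambda>x. ?D x ^ 4) + 8 * expectation ?D ^ 4"
    using bD by (subst Bochner_Integration.integral_add) (auto intro!: bounded_rv_integrable simp: prob_space)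
  also have "\<dots> \<le> 16 * C"
    using almost_additive[OF assms] expectation_power4_le[OF bD] by simp
  finally show ?thesis .
qed

lemma indep_G: "mono t \<Longrightarrow> indep_vars (\<lambda>_. borel) (\<lambda>i. G (t i) (t (i + 1))) (UNIV :: nat set)"
  unfolding G_def[abs_def]
  by (rule indep_vars_compose2[where Y="\<lambda>i y. y - expectation (F 0 (t (i + 1) - t i))", OF indep]) auto

lemma indep_var_G:
  assumes "a \<le> b" "b \<le> c"
  shows "indep_var borel (G a b) borel (G b c)"
proof -
  \<comment> \<open>Blocks 0 and 1 of this sequence are the two in question; from index 2 on it is
    constant.\<close>
  define t :: "nat \<Rightarrow> nat" where "t i = (if i = 0 then a else if i = 1 then b else c)" for i
  have "mono t" using assms by (auto simp: mono_def t_def)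
  from indep_vars_subset[OF indep_G[OF this], of "insert 0 {1}"]
  have "indep_var borel (\<lambda>x. G (t 0) (t (0 + 1)) x) borel (\<lambda>x. \<Sum>i\<in>{1::nat}. G (t i) (t (i + 1)) x)"
    by (intro indep_vars_sum) auto
  then show ?thesis by (simp add: t_def)
qed

text \<open>\<open>G 0 p\<close> and \<open>G p (p + q)\<close> are independent and centred, so
  \<open>sqrt (v p + v q)\<close> is the norm of their sum, and this sum differs from
  \<open>G 0 (p + q)\<close> by \<open>D\<close>. In terms of standard deviations the error is a
  constant; for variances the resulting bound would grow with \<open>v\<close>.\<close>

lemma v_add_diff:
  "\<bar>sqrt (v (p + q)) - sqrt (v p + v q)\<bar> \<le> d"
proof -
  have "expectation (\<lambda>x. (G 0 p x + G p (p + q) x)\<^sup>2) = v p + v q"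
    using expectation_power2_add[OF indep_var_G[of 0 p "p + q"]] expectation_G[of 0 p]
      expectation_G_stationary[of "\<lambda>x. x\<^sup>2" p "p + q"]
    by (auto simp: v_def)
  then have "L2norm (\<lambda>x. G 0 p x + G p (p + q) x) = sqrt (v p + v q)"
    by (simp add: L2norm_def)
  moreover have "(\<lambda>x. G 0 (p + q) x - (G 0 p x + G p (p + q) x)) = D 0 p (p + q)"
    by (auto simp: D_def)
  ultimately show ?thesis
    using L2norm_diff_triangle[OF bounded_G bounded_rv_add[OF bounded_G bounded_G], of 0 "p + q" 0 p p "p + q"]
      L2norm_D[of 0 p "p + q"] L2norm_G[of 0 "p + q"]
    by auto
qed

text \<open>From \<open>2 * A * d \<le> A\<^sup>2 / 4 + 4 * d\<^sup>2\<close>. The factor 5/4 yields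
  the base \<open>5/2 = 2 * (5/4)\<close> under repeated halving.\<close>

lemma v_add_le: "v (p + q) \<le> 5/4 * (v p + v q) + 5 * d\<^sup>2"
proof -
  have "sqrt (v (p + q)) \<le> sqrt (v p + v q) + d"
    using v_add_diff[of p q] by linarith
  then have "(sqrt (v (p + q)))\<^sup>2 \<le> (sqrt (v p + v q) + d)\<^sup>2"
    using v_nonneg by (intro power_mono) auto
  also have "\<dots> \<le> 5/4 * (sqrt (v p + v q))\<^sup>2 + 5 * d\<^sup>2"
    using zero_le_power2[of "sqrt (v p + v q) / 2 - 2 * d"] 
    by (simp add: power2_sum power2_diff power_divide power_mult_distrib)
  finally show ?thesis using v_nonneg by simp
qed

text \<open>A crude bound for remainder blocks of arbitrary length: the base only has to exceed 2 for
  the induction and to be less than \<open>sqrt 8\<close> for the choice of the block length below.\<close>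

lemma v_le_power: "\<exists>K\<ge>0. \<forall>j m. m \<le> 2 ^ j \<longrightarrow> v m \<le> K * (5/2) ^ j"
proof -
  define K where "K = v 0 + v 1 + 5 * d\<^sup>2"
  \<comment> \<open>The summand \<open>5 * d\<^sup>2\<close> absorbs the additive error: the
    induction step needs \<open>10 * d\<^sup>2\<close> and receives
    \<open>5/4 * (10 * d\<^sup>2)\<close> from the two halves.\<close>
  have "v m + 5 * d\<^sup>2 \<le> K * (5/2) ^ j" if "m \<le> 2 ^ j" for j m
    using that
  proof (induction j arbitrary: m)
    case 0
    then have "m = 0 \<or> m = 1" by auto
    then show ?case using v_nonneg[of 0] v_nonneg[of 1] by (auto simp: K_def)
  next
    case (Suc j)
    have "m = m div 2 + (m - m div 2)" "m div 2 \<le> 2 ^ j" "m - m div 2 \<le> 2 ^ j"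
      using Suc.prems by auto
    then obtain p q where m: "m = p + q" and pq: "p \<le> 2 ^ j" "q \<le> 2 ^ j" by blast
    define P where "P = K * (5/2) ^ j"
    have "v p + 5 * d\<^sup>2 \<le> P" "v q + 5 * d\<^sup>2 \<le> P"
      unfolding P_def using Suc.IH pq by auto
    then have "v m + 5 * d\<^sup>2 \<le> 5/2 * P"
      using v_add_le[of p q] zero_le_power2[of d] unfolding m by argo
    then show ?case by (simp add: P_def)
  qed
  then have "v m \<le> K * (5/2) ^ j" if "m \<le> 2 ^ j" for j m
    using that zero_le_power2[of d] by (smt (verit))
  moreover have "0 \<le> K" using v_nonneg by (simp add: K_def)
  ultimately show ?thesis by blast
qed

lemma sqrt_v_dyadic:
  "\<bar>sqrt (v (2 ^ Suc j) / 2 ^ Suc j) - sqrt (v (2 ^ j) / 2 ^ j)\<bar> \<le> d * (1 / sqrt 2) ^ Suc j"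
proof -
  have "sqrt (v (2 ^ j) + v (2 ^ j)) / sqrt (2 ^ Suc j) = sqrt (v (2 ^ j) / 2 ^ j)"
    by (simp add: real_sqrt_divide[symmetric])
  then have "sqrt (v (2 ^ Suc j) / 2 ^ Suc j) - sqrt (v (2 ^ j) / 2 ^ j)
      = (sqrt (v (2 ^ Suc j)) - sqrt (v (2 ^ j) + v (2 ^ j))) / sqrt (2 ^ Suc j)"
    by (simp add: real_sqrt_divide diff_divide_distrib)
  also have "\<bar>\<dots>\<bar> = \<bar>sqrt (v (2 ^ Suc j)) - sqrt (v (2 ^ j) + v (2 ^ j))\<bar> / sqrt (2 ^ Suc j)"
    by (simp only: abs_divide abs_of_nonneg[OF real_sqrt_ge_zero] zero_le_power zero_le_numeral)
  also have "\<dots> \<le> d / sqrt (2 ^ Suc j)"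
  proof (rule divide_right_mono)
    show "\<bar>sqrt (v (2 ^ Suc j)) - sqrt (v (2 ^ j) + v (2 ^ j))\<bar> \<le> d"
      using v_add_diff[of "2 ^ j" "2 ^ j"] by (simp only: power_Suc mult_2)
  qed simp
  also have "\<dots> = d * (1 / sqrt 2) ^ Suc j"
    by (simp only: real_sqrt_power power_one_over) simp
  finally show ?thesis .
qed

text \<open>A doubling changes the standard deviation by at most \<open>d\<close> from its value
  under exact additivity of variances; after normalisation these changes are dominated by a
  geometric series. Along powers of 2 no remainder arises.\<close>

lemma v_dyadic_limit: "\<exists>\<sigma>2\<ge>0. (\<lambda>j. v (2 ^ j) / 2 ^ j) \<longlonglongrightarrow> \<sigma>2"
proof -
  define t where "t j = sqrt (v (2 ^ j) / 2 ^ j)" for j :: nat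
  have "summable (\<lambda>j. t (Suc j) - t j)"
  proof (rule summable_comparison_test')
    show "summable (\<lambda>j. d * (1 / sqrt 2) ^ Suc j)"
      unfolding summable_Suc_iff by (intro summable_mult summable_geometric) simp
    show "norm (t (Suc j) - t j) \<le> d * (1 / sqrt 2) ^ Suc j" if "j \<ge> 0" for j
      using sqrt_v_dyadic[of j] by (simp only: t_def real_norm_def)
  qed
  then have "(\<lambda>n. \<Sum>j<n. t (Suc j) - t j) \<longlonglongrightarrow> (\<Sum>j. t (Suc j) - t j)"
    by (rule summable_LIMSEQ)
  then have "(\<lambda>n. (t n - t 0) + t 0) \<longlonglongrightarrow> (\<Sum>j. t (Suc j) - t j) + t 0"
    unfolding sum_lessThan_telescope by (intro tendsto_intros)
  then have "(\<lambda>n. (t n)\<^sup>2) \<longlonglongrightarrow> ((\<Sum>j. t (Suc j) - t j) + t 0)\<^sup>2"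
    by (intro tendsto_power) simp
  moreover have "(t n)\<^sup>2 = v (2 ^ n) / 2 ^ n" for n
    using v_nonneg by (simp add: t_def)
  ultimately show ?thesis
    by (intro exI[of _ "((\<Sum>j. t (Suc j) - t j) + t 0)\<^sup>2"]) simp
qed

text \<open>The factor of \<open>m4 n\<close> is \<open>2 * (6/5) ^ 3\<close>; all that matters is that it is less than 4.\<close>

lemma m4_double_le: "m4 (2 * n) \<le> 4 * (432/500 * m4 n) + 11 * (v n)\<^sup>2 + 3456 * C"
proof -
  let ?S = "\<lambda>x. G 0 n x + G n (2 * n) x"
  have S4: "expectation (\<lambda>x. ?S x ^ 4) = 2 * m4 n + 6 * (v n)\<^sup>2"
    using expectation_power4_add[OF indep_var_G[of 0 n "2 * n"]] expectation_G
      expectation_G_stationary[of "\<lambda>x. x\<^sup>2" n "2 * n"] expectation_G_stationary[of "\<lambda>x. x ^ 4" n "2 * n"]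
    by (auto simp: v_def m4_def power2_eq_square)
  have "m4 (2 * n) \<le> expectation (\<lambda>x. 1728/1000 * ?S x ^ 4 + 216 * D 0 n (2 * n) x ^ 4)"
    unfolding m4_def
  proof (rule expectation_mono)
    fix x
    \<comment> \<open>The inequality \<open>(p + q)\<^sup>2 \<le> (1 + \<eta>) * p\<^sup>2 + (1 + 1
      / \<eta>) * q\<^sup>2\<close> with \<open>\<eta> = 1/5\<close> is used twice, which gives
      \<open>1728/1000 = (6/5) ^ 3\<close> and \<open>216 = 6 ^ 3\<close>.\<close>
    have "(p + q) ^ 4 \<le> 1728/1000 * p ^ 4 + 216 * q ^ 4" for p q :: real
    proof -
      have "((p + q)\<^sup>2)\<^sup>2 \<le> (6/5 * p\<^sup>2 + 6 * q\<^sup>2)\<^sup>2"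
        using zero_le_power2[of "p - 5 * q"]
        by (intro power_mono zero_le_power2) (simp add: power2_sum power2_diff power_mult_distrib)
      also have "\<dots> \<le> 6/5 * (6/5 * p\<^sup>2)\<^sup>2 + 6 * (6 * q\<^sup>2)\<^sup>2"
        using zero_le_power2[of "6/5 * p\<^sup>2 - 5 * (6 * q\<^sup>2)"]
        by (simp add: power2_sum power2_diff power_mult_distrib power_mult[symmetric])
      finally show ?thesis by (simp add: power_mult_distrib power_mult[symmetric] power2_eq_square[of "_ / _"])
    qed
    from this[of "?S x" "D 0 n (2 * n) x"]
    show "G 0 (2 * n) x ^ 4 \<le> 1728/1000 * ?S x ^ 4 + 216 * D 0 n (2 * n) x ^ 4"
      by (simp add: D_def)
  qed auto
  also have "\<dots> = 1728/1000 * expectation (\<lambda>x. ?S x ^ 4) + 216 * expectation (\<lambda>x. D 0 n (2 * n) x ^ 4)"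
    by (subst Bochner_Integration.integral_add) (auto intro!: bounded_rv_integrable simp del: times_divide_eq_left)
  also have "\<dots> \<le> 1728/1000 * (2 * m4 n + 6 * (v n)\<^sup>2) + 216 * (16 * C)"
    unfolding S4 using expectation_D_power4[of 0 n "2 * n"] by (intro add_mono mult_left_mono) auto
  also have "\<dots> = 4 * (432/500 * m4 n) + 1296/125 * (v n)\<^sup>2 + 3456 * C"
    by (simp add: field_simps)
  also have "\<dots> \<le> 4 * (432/500 * m4 n) + 11 * (v n)\<^sup>2 + 3456 * C"
    by (rule add_right_mono, rule add_left_mono, rule mult_right_mono) simp_all
  finally show ?thesis .
qed

text \<open>Divided by the square of the length, the fourth moment is contracted by 432/500 +
  432/500 * 0 at each doubling, up to a bounded term: the squared variance is of quadratic order
  because \<open>v (2 ^ j) / 2 ^ j\<close> converges.\<close>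

lemma m4_dyadic_le: "\<exists>B\<ge>0. \<forall>j. m4 (2 ^ j) \<le> B * (2 ^ j)\<^sup>2"
proof -
  obtain \<sigma>2 where "(\<lambda>j. v (2 ^ j) / 2 ^ j) \<longlonglongrightarrow> \<sigma>2" using v_dyadic_limit by blast
  then have "Bseq (\<lambda>j. v (2 ^ j) / 2 ^ j)" by (intro convergent_imp_Bseq) (auto simp: convergent_def)
  then obtain V where V: "\<bar>v (2 ^ j) / 2 ^ j\<bar> \<le> V" for j by (auto simp: Bseq_def)
  have v2: "(v (2 ^ j))\<^sup>2 \<le> V\<^sup>2 * (2 ^ j)\<^sup>2" for j
  proof -
    have "v (2 ^ j) \<le> V * 2 ^ j" using V[of j] v_nonneg[of "2 ^ j"] by (simp add: field_simps)
    then have "(v (2 ^ j))\<^sup>2 \<le> (V * 2 ^ j)\<^sup>2" by (intro power_mono v_nonneg)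
    then show ?thesis by (simp add: power_mult_distrib)
  qed
  \<comment> \<open>The induction closes once \<open>11 * V\<^sup>2 + 3456 * C\<close> is at most
    \<open>4 * (1 - 432/500) * B\<close>; the factor 100 is generous.\<close>
  define B where "B = m4 1 + 100 * (11 * V\<^sup>2 + 3456 * C)"
  have m4_nonneg: "0 \<le> m4 n" for n by (simp add: m4_def)
  have B: "0 \<le> B" using m4_nonneg C_nonneg by (simp add: B_def)
  have "m4 (2 ^ j) \<le> B * (2 ^ j)\<^sup>2" for j
  proof (induction j)
    case 0
    then show ?case using C_nonneg by (simp add: B_def)
  next
    case (Suc j)
    have one: "1 \<le> (2 ^ j :: real)\<^sup>2" by simp
    have "m4 (2 ^ Suc j) \<le> 4 * (432/500 * m4 (2 ^ j)) + 11 * (v (2 ^ j))\<^sup>2 + 3456 * C"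
      using m4_double_le[of "2 ^ j"] by simp
    also have "\<dots> \<le> 4 * (432/500 * (B * (2 ^ j)\<^sup>2)) + 11 * (V\<^sup>2 * (2 ^ j)\<^sup>2) + 3456 * (C * (2 ^ j)\<^sup>2)"
      using Suc.IH v2 mult_left_mono[OF one C_nonneg] by (intro add_mono mult_left_mono) auto
    also have "\<dots> = (4 * (432/500) * B + (11 * V\<^sup>2 + 3456 * C)) * (2 ^ j)\<^sup>2"
      by (simp add: algebra_simps)
    also have "\<dots> \<le> (4 * B) * (2 ^ j)\<^sup>2"
    proof (rule mult_right_mono)
      have "11 * V\<^sup>2 + 3456 * C \<le> B / 100" using m4_nonneg[of 1] by (simp add: B_def)
      then show "4 * (432/500) * B + (11 * V\<^sup>2 + 3456 * C) \<le> 4 * B" using B by simp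
    qed simp
    also have "\<dots> = B * (2 ^ Suc j)\<^sup>2" by (simp add: power_mult_distrib)
    finally show ?case .
  qed
  then show ?thesis using B by blast
qed

section \<open>Decomposition into blocks\<close>

lemma G_zero: "L2norm (G 0 0) \<le> d"
proof -
  have "D 0 0 0 = (\<lambda>x. - G 0 0 x)" by (simp add: D_def fun_eq_iff)
  then show ?thesis using L2norm_D[of 0 0 0] by (simp add: L2norm_def)
qed

text \<open>Each appended block contributes one defect \<open>D\<close>. The additional
  \<open>d\<close> pays for the empty block \<open>G 0 0\<close>, which is
  \<open>- D 0 0 0\<close>.\<close>

lemma L2norm_sum_blocks:
  "L2norm (\<lambda>x. G 0 (k * l) x - (\<Sum>i<k. G (i * l) ((i + 1) * l) x)) \<le> (real k + 1) * d"
proof (induction k)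
  case 0
  then show ?case using G_zero by simp
next
  case (Suc k)
  let ?A = "\<lambda>x. G 0 (k * l) x - (\<Sum>i<k. G (i * l) ((i + 1) * l) x)"
  have "L2norm (\<lambda>x. G 0 (Suc k * l) x - (\<Sum>i<Suc k. G (i * l) ((i + 1) * l) x))
      = L2norm (\<lambda>x. ?A x + D 0 (k * l) (Suc k * l) x)"
    by (rule arg_cong[where f=L2norm]) (simp add: fun_eq_iff D_def)
  also have "\<dots> \<le> L2norm ?A + L2norm (D 0 (k * l) (Suc k * l))"
    by (rule L2norm_triangle) auto
  also have "\<dots> \<le> (real k + 1) * d + d"
    by (rule add_mono[OF Suc.IH L2norm_D]) simp_all
  also have "\<dots> = (real (Suc k) + 1) * d" by (simp add: algebra_simps)
  finally show ?case .
qed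

lemma L2norm_blocks:
  "L2norm (\<lambda>x. G 0 (k * l + r) x - (\<Sum>i<k. G (i * l) ((i + 1) * l) x)) \<le> (real k + 2) * d + sqrt (v r)"
proof -
  let ?A = "\<lambda>x. G 0 (k * l) x - (\<Sum>i<k. G (i * l) ((i + 1) * l) x)"
  have "L2norm (\<lambda>x. G 0 (k * l + r) x - (\<Sum>i<k. G (i * l) ((i + 1) * l) x))
      = L2norm (\<lambda>x. ?A x + (D 0 (k * l) (k * l + r) x + G (k * l) (k * l + r) x))"
    by (rule arg_cong[where f=L2norm]) (simp add: fun_eq_iff D_def)
  also have "\<dots> \<le> L2norm ?A + L2norm (\<lambda>x. D 0 (k * l) (k * l + r) x + G (k * l) (k * l + r) x)"
    by (rule L2norm_triangle) auto
  also have "\<dots> \<le> L2norm ?A + (L2norm (D 0 (k * l) (k * l + r)) + L2norm (G (k * l) (k * l + r)))"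
    by (intro add_left_mono L2norm_triangle) auto
  also have "\<dots> \<le> (real k + 1) * d + (d + sqrt (v r))"
    using L2norm_G[of "k * l" "k * l + r"] L2norm_D[of 0 "k * l" "k * l + r"]
    by (intro add_mono[OF L2norm_sum_blocks]) simp
  also have "\<dots> = (real k + 2) * d + sqrt (v r)" by (simp add: algebra_simps)
  finally show ?thesis .
qed

lemma indep_blocks: "indep_vars (\<lambda>_. borel) (\<lambda>i. G (i * l) ((i + 1) * l)) (UNIV :: nat set)"
  by (rule indep_G) (auto simp: mono_def)

lemma L2norm_sum_indep_blocks:
  "L2norm (\<lambda>x. \<Sum>i<k. G (i * l) ((i + 1) * l) x) = sqrt (real k * v l)"
proof -
  have "expectation (\<lambda>x. (\<Sum>i<k. G (i * l) ((i + 1) * l) x)\<^sup>2) = real k * v l"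
  proof (induction k)
    case (Suc k)
    let ?S = "\<lambda>x. \<Sum>i<k. G (i * l) ((i + 1) * l) x"
    have "indep_var borel (G (k * l) ((k + 1) * l)) borel ?S"
      by (rule indep_vars_sum[OF _ _ indep_vars_subset[OF indep_blocks subset_UNIV]]) auto
    then have "expectation (\<lambda>x. (G (k * l) ((k + 1) * l) x + ?S x)\<^sup>2)
        = expectation (\<lambda>x. (G (k * l) ((k + 1) * l) x)\<^sup>2) + expectation (\<lambda>x. (?S x)\<^sup>2)"
      by (intro expectation_power2_add) (auto intro: expectation_G)
    also have "expectation (\<lambda>x. (G (k * l) ((k + 1) * l) x)\<^sup>2) = v l"
      using expectation_G_stationary[of "\<lambda>x. x\<^sup>2" "k * l" "(k + 1) * l"] by (simp add: v_def)
    finally show ?case using Suc.IH by (simp add: algebra_simps)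
  qed simp
  then show ?thesis by (simp add: L2norm_def)
qed

section \<open>Characteristic functions of blocks\<close>

definition \<phi> :: "nat \<Rightarrow> real \<Rightarrow> complex" where
  "\<phi> l s = char (distr M borel (G 0 l)) s"

lemma char_G: "a \<le> b \<Longrightarrow> char (distr M borel (G a b)) s = \<phi> (b - a) s"
proof -
  assume ab: "a \<le> b"
  have "distr M borel (G c e) = distr (distr M borel (F c e)) borel (\<lambda>y. y - expectation (F 0 (e - c)))" for c e
    by (subst distr_distr) (auto simp: comp_def G_def[abs_def])
  then have "distr M borel (G a b) = distr M borel (G 0 (b - a))"
    using ab stationary[of a "b - a"] by simp
  then show ?thesis by (simp add: \<phi>_def)
qed

lemma cmod_\<phi>_le_1: "cmod (\<phi> l s) \<le> 1"
  unfolding \<phi>_def by (intro real_distribution.cmod_char_le_1 real_distribution_distr) simp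

text \<open>The blocks are independent with equal laws, so their sum has characteristic function
  \<open>\<phi> l s ^ k\<close>. Passing from \<open>G 0 (k * l + r)\<close> to this sum costs
  \<open>\<bar>s\<bar>\<close> times the L1 distance, which the L2 distance dominates.\<close>

lemma \<phi>_blocks:
  "cmod (\<phi> (k * l + r) s - \<phi> l s ^ k) \<le> \<bar>s\<bar> * ((real k + 2) * d + sqrt (v r))"
proof -
  let ?S = "\<lambda>x. \<Sum>i<k. G (i * l) ((i + 1) * l) x"
  have "char (distr M borel ?S) s = (\<Prod>i<k. char (distr M borel (G (i * l) ((i + 1) * l))) s)"
    by (rule char_distr_sum[OF indep_vars_subset[OF indep_blocks subset_UNIV]])
  also have "\<dots> = \<phi> l s ^ k"
    using char_G[of "_ * l" "(_ + 1) * l" s] by simp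
  finally have S: "char (distr M borel ?S) s = \<phi> l s ^ k" .
  have "cmod (char (distr M borel (G 0 (k * l + r))) s - char (distr M borel ?S) s)
      \<le> \<bar>s\<bar> * expectation (\<lambda>x. \<bar>G 0 (k * l + r) x - ?S x\<bar>)"
    by (rule char_diff_le) auto
  then have "cmod (\<phi> (k * l + r) s - \<phi> l s ^ k) \<le> \<bar>s\<bar> * expectation (\<lambda>x. \<bar>G 0 (k * l + r) x - ?S x\<bar>)"
    unfolding S \<phi>_def[symmetric] .
  also have "\<dots> \<le> \<bar>s\<bar> * ((real k + 2) * d + sqrt (v r))"
    by (intro mult_left_mono order.trans[OF expectation_abs_le_L2norm L2norm_blocks]) auto
  finally show ?thesis .
qed

text \<open>The third-order error involves the third absolute moment, which is estimated by the
  second and fourth moments. The weight \<open>sqrt l\<close>, the natural size of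
  \<open>G 0 l\<close>, balances the two.\<close>

lemma \<phi>_approx:
  assumes "0 < l"
  shows "cmod (\<phi> l s - (1 - s\<^sup>2 * v l / 2)) \<le> \<bar>s\<bar> ^ 3 / 12 * (sqrt l * v l + m4 l / sqrt l)"
proof -
  have pos: "0 < sqrt l" using assms by simp
  have "variance (G 0 l) = v l"
    using expectation_G[of 0 l] by (simp add: v_def)
  then have "cmod (\<phi> l s - (1 - s\<^sup>2 * v l / 2))
      \<le> s\<^sup>2 / 6 * expectation (\<lambda>x. min (6 * (G 0 l x)\<^sup>2) (\<bar>s\<bar> * \<bar>G 0 l x\<bar> ^ 3))"
    unfolding \<phi>_def by (intro char_approx3') (auto intro!: bounded_rv_integrable expectation_G)
  also have "\<dots> \<le> s\<^sup>2 / 6 * expectation (\<lambda>x. \<bar>s\<bar> * ((sqrt l / 2) * (G 0 l x)\<^sup>2 + (1 / (2 * sqrt l)) * G 0 l x ^ 4))"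
  proof (intro mult_left_mono integral_mono)
    show "integrable M (\<lambda>x. min (6 * (G 0 l x)\<^sup>2) (\<bar>s\<bar> * \<bar>G 0 l x\<bar> ^ 3))"
      by (intro integrable_min bounded_rv_integrable) auto
    show "integrable M (\<lambda>x. \<bar>s\<bar> * ((sqrt l / 2) * (G 0 l x)\<^sup>2 + (1 / (2 * sqrt l)) * G 0 l x ^ 4))"
      by (intro bounded_rv_integrable) auto
    fix x
    have "y ^ 3 \<le> (sqrt l / 2) * y\<^sup>2 + (1 / (2 * sqrt l)) * y ^ 4" for y :: real
    proof -
      have "0 \<le> y\<^sup>2 * (y - sqrt l)\<^sup>2 / (2 * sqrt l)" using pos by simp
      also have "\<dots> = (sqrt l / 2) * y\<^sup>2 + (1 / (2 * sqrt l)) * y ^ 4 - y ^ 3"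
        using pos by (simp add: divide_simps power2_eq_square power3_eq_cube power4_eq_xxxx del: real_sqrt_mult_self)
          (simp add: algebra_simps del: real_sqrt_mult_self)
      finally show ?thesis by simp
    qed
    from this[of "\<bar>G 0 l x\<bar>"]
    show "min (6 * (G 0 l x)\<^sup>2) (\<bar>s\<bar> * \<bar>G 0 l x\<bar> ^ 3) \<le> \<bar>s\<bar> * ((sqrt l / 2) * (G 0 l x)\<^sup>2 + (1 / (2 * sqrt l)) * G 0 l x ^ 4)"
      by (intro order.trans[OF min.cobounded2] mult_left_mono) (auto simp: power_even_abs)
  qed auto
  also have "expectation (\<lambda>x. \<bar>s\<bar> * ((sqrt l / 2) * (G 0 l x)\<^sup>2 + (1 / (2 * sqrt l)) * G 0 l x ^ 4))
      = \<bar>s\<bar> * ((sqrt l / 2) * v l + (1 / (2 * sqrt l)) * m4 l)"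
    unfolding v_def m4_def
    by (subst integral_mult_right_zero, subst Bochner_Integration.integral_add)
       (auto intro!: bounded_rv_integrable simp del: times_divide_eq_left)
  also have "s\<^sup>2 / 6 * (\<bar>s\<bar> * ((sqrt l / 2) * v l + (1 / (2 * sqrt l)) * m4 l))
      = \<bar>s\<bar> ^ 3 / 12 * (sqrt l * v l + m4 l / sqrt l)"
    using pos power2_abs[of s]
    by (simp add: power3_eq_cube power2_eq_square divide_simps del: real_sqrt_mult_self abs_mult_self_eq)
  finally show ?thesis .
qed

lemma \<phi>_power_approx:
  assumes "0 < l"
  shows "cmod (\<phi> l s ^ k - exp (- (real k * (s\<^sup>2 * v l / 2))))
    \<le> real k * (\<bar>s\<bar> ^ 3 / 12 * (sqrt l * v l + m4 l / sqrt l) + (s\<^sup>2 * v l / 2)\<^sup>2)"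
proof -
  define \<theta> where "\<theta> = s\<^sup>2 * v l / 2"
  have \<theta>: "0 \<le> \<theta>" using v_nonneg by (simp add: \<theta>_def)
  \<comment> \<open>Both bases lie in the closed unit disc, so their \<open>k\<close>-th powers
    differ by at most \<open>k\<close> times the difference of the bases.\<close>
  have "cmod (\<phi> l s ^ k - (complex_of_real (exp (- \<theta>))) ^ k) \<le> real k * cmod (\<phi> l s - complex_of_real (exp (- \<theta>)))"
    using \<theta> by (intro norm_power_diff cmod_\<phi>_le_1) simp
  also have "\<dots> \<le> real k * (cmod (\<phi> l s - (1 - \<theta>)) + cmod (complex_of_real (exp (- \<theta>) - (1 - \<theta>))))"
    by (intro mult_left_mono) (auto intro!: order.trans[OF _ norm_triangle_ineq4])
  also have "\<dots> \<le> real k * (\<bar>s\<bar> ^ 3 / 12 * (sqrt l * v l + m4 l / sqrt l) + \<theta>\<^sup>2)"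
    using \<phi>_approx[OF assms, of s] exp_minus_approx[OF \<theta>]
    by (intro mult_left_mono add_mono) (simp_all only: \<theta>_def norm_of_real of_nat_0_le_iff of_real_divide of_real_mult of_real_power of_real_numeral)
  also have "(complex_of_real (exp (- \<theta>))) ^ k = exp (- (real k * \<theta>))"
    by (simp add: exp_of_nat_mult[symmetric] exp_of_real[symmetric])
  finally show ?thesis by (simp add: \<theta>_def)
qed

lemma v_blocks: "\<bar>sqrt (v (k * l + r)) - sqrt (real k * v l)\<bar> \<le> (real k + 2) * d + sqrt (v r)"
proof -
  have b: "bounded_rv (\<lambda>x. \<Sum>i<k. G (i * l) ((i + 1) * l) x)" by auto
  have "\<bar>L2norm (G 0 (k * l + r)) - L2norm (\<lambda>x. \<Sum>i<k. G (i * l) ((i + 1) * l) x)\<bar>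
      \<le> (real k + 2) * d + sqrt (v r)"
    by (rule order.trans[OF L2norm_diff_triangle[OF bounded_G b] L2norm_blocks])
  then show ?thesis
    unfolding L2norm_sum_indep_blocks by (simp add: L2norm_G)
qed

end

text \<open>Block lengths of order \<open>n powr (2/3)\<close>: the number of blocks is \<open>o(sqrt n)\<close>, so that
  the errors of almost additivity are negligible, and a single block is negligible too.\<close>

definition block_exp :: "nat \<Rightarrow> nat" where
  "block_exp n = (SOME j. 8 ^ j \<le> n\<^sup>2 \<and> n\<^sup>2 < 8 ^ Suc j)"

lemma block_exp:
  assumes "0 < n"
  shows "8 ^ block_exp n \<le> n\<^sup>2" "n\<^sup>2 < 8 ^ Suc (block_exp n)"
proof -
  have "\<exists>j. 8 ^ j \<le> n\<^sup>2 \<and> n\<^sup>2 < 8 ^ (j + 1)"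
    using assms by (intro ex_power_ivl1) auto
  then have "\<exists>j. 8 ^ j \<le> n\<^sup>2 \<and> n\<^sup>2 < 8 ^ Suc j" by simp
  from someI_ex[OF this] show "8 ^ block_exp n \<le> n\<^sup>2" "n\<^sup>2 < 8 ^ Suc (block_exp n)"
    unfolding block_exp_def by auto
qed

lemma filterlim_block_exp: "filterlim block_exp at_top sequentially"
  unfolding filterlim_at_top
proof
  fix Z
  have "Z \<le> block_exp n" if "n \<ge> 8 ^ Suc Z" for n
  proof (rule ccontr)
    have n: "0 < n" using that by (rule order.strict_trans2[rotated]) simp
    assume "\<not> Z \<le> block_exp n"
    then have "(8 :: nat) ^ Suc (block_exp n) \<le> 8 ^ Z" by (intro power_increasing) auto
    also have "\<dots> \<le> 8 ^ Suc Z" by simp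
    also have "\<dots> \<le> n" by fact
    also have "\<dots> \<le> n\<^sup>2" by (simp add: power2_eq_square)
    also have "\<dots> < 8 ^ Suc (block_exp n)" by (rule block_exp(2)[OF n])
    finally show False by simp
  qed
  then show "\<forall>\<^sub>F n in sequentially. Z \<le> block_exp n"
    by (auto simp: eventually_sequentially)
qed

section \<open>Asymptotics of the block decomposition\<close>

definition block_len :: "nat \<Rightarrow> nat" where
  "block_len n = 2 ^ block_exp n"

definition block_num :: "nat \<Rightarrow> nat" where
  "block_num n = n div block_len n"

definition block_rem :: "nat \<Rightarrow> nat" where
  "block_rem n = n mod block_len n"

lemma block_len_pos: "0 < block_len n"
  by (simp add: block_len_def)

lemma block_len_cube:
  assumes "0 < n"
  shows "real (block_len n) ^ 3 \<le> (real n)\<^sup>2" "(real n)\<^sup>2 < 8 * real (block_len n) ^ 3"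
proof -
  have "(8 :: nat) = 2 ^ 3" by simp
  then have "block_len n ^ 3 = 8 ^ block_exp n"
    by (simp only: block_len_def power_mult[symmetric] mult.commute)
  then have "block_len n ^ 3 \<le> n\<^sup>2" "n\<^sup>2 < 8 * block_len n ^ 3"
    using block_exp[OF assms] by auto
  then have "real (block_len n ^ 3) \<le> real (n\<^sup>2)" "real (n\<^sup>2) < real (8 * block_len n ^ 3)"
    by (simp_all only: of_nat_less_iff of_nat_le_iff)
  then show "real (block_len n) ^ 3 \<le> (real n)\<^sup>2" "(real n)\<^sup>2 < 8 * real (block_len n) ^ 3"
    by simp_all
qed

lemma blocks_plus_rem: "block_num n * block_len n + block_rem n = n"
  by (simp add: block_num_def block_rem_def)

lemma inverse_block_len_tendsto: "(\<lambda>n. 1 / real (block_len n)) \<longlonglongrightarrow> 0"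
proof -
  have "(\<lambda>j. (1/2 :: real) ^ j) \<longlonglongrightarrow> 0" by (intro LIMSEQ_power_zero) simp
  from filterlim_compose[OF this filterlim_block_exp] show ?thesis
    by (simp add: block_len_def power_one_over)
qed

text \<open>The cube of the length is at most \<open>n\<^sup>2\<close>, so the squared ratio is at
  most the inverse of the length.\<close>

lemma block_len_ratio_tendsto: "(\<lambda>n. real (block_len n) / real n) \<longlonglongrightarrow> 0"
proof (rule tendsto_sandwich)
  show "\<forall>\<^sub>F n in sequentially. 0 \<le> real (block_len n) / real n" by simp
  show "\<forall>\<^sub>F n in sequentially. real (block_len n) / real n \<le> sqrt (1 / real (block_len n))"
    using eventually_gt_at_top[of 0]
  proof eventually_elim
    case (elim n)
    have "(real (block_len n) / real n)\<^sup>2 \<le> 1 / real (block_len n)"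
      using block_len_cube(1)[OF elim] block_len_pos[of n] elim
      by (simp add: power_divide divide_simps power3_eq_cube power2_eq_square)
    then show ?case by (rule real_le_rsqrt)
  qed
  show "(\<lambda>n. sqrt (1 / real (block_len n))) \<longlonglongrightarrow> 0"
    using tendsto_real_sqrt[OF inverse_block_len_tendsto] by simp
qed simp

lemma blocks_ratio_tendsto: "(\<lambda>n. real (block_num n) * real (block_len n) / real n) \<longlonglongrightarrow> 1"
proof (rule tendsto_sandwich)
  show "\<forall>\<^sub>F n in sequentially. 1 - real (block_len n) / real n \<le> real (block_num n) * real (block_len n) / real n"
    using eventually_gt_at_top[of 0]
  proof eventually_elim
    case (elim n)
    have "block_rem n < block_len n" using block_len_pos[of n] by (simp add: block_rem_def)
    then have "real n \<le> real (block_num n) * real (block_len n) + real (block_len n)"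
      by (subst blocks_plus_rem[of n, symmetric]) (simp flip: of_nat_mult of_nat_add)
    then have "real n / real n \<le> (real (block_num n) * real (block_len n) + real (block_len n)) / real n"
      by (rule divide_right_mono) simp
    then show ?case using elim by (simp add: add_divide_distrib)
  qed
  show "\<forall>\<^sub>F n in sequentially. real (block_num n) * real (block_len n) / real n \<le> 1"
    using eventually_gt_at_top[of 0]
  proof eventually_elim
    case (elim n)
    have "real (block_num n) * real (block_len n) \<le> real n"
      by (subst blocks_plus_rem[of n, symmetric]) (simp flip: of_nat_mult of_nat_add)
    then show ?case using elim by simp
  qed
  show "(\<lambda>n. 1 - real (block_len n) / real n) \<longlonglongrightarrow> 1"
    using tendsto_diff[OF tendsto_const block_len_ratio_tendsto, of 1] by simp
qed simp

text \<open>With blocks of length \<open>l\<close> there are at most \<open>n / l\<close> of them,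
  so the squared ratio is at most \<open>n / l\<^sup>2\<close>; the square of this is at most
  \<open>8 / l\<close> because \<open>n\<^sup>2 < 8 * l ^ 3\<close>.\<close>

lemma block_num_ratio_tendsto: "(\<lambda>n. real (block_num n) / sqrt (real n)) \<longlonglongrightarrow> 0"
proof (rule tendsto_sandwich)
  show "\<forall>\<^sub>F n in sequentially. 0 \<le> real (block_num n) / sqrt (real n)" by simp
  show "\<forall>\<^sub>F n in sequentially. real (block_num n) / sqrt (real n) \<le> sqrt (sqrt (8 * (1 / real (block_len n))))"
    using eventually_gt_at_top[of 0]
  proof eventually_elim
    case (elim n)
    have "real (block_num n) * real (block_len n) \<le> real n"
      by (subst blocks_plus_rem[of n, symmetric]) (simp flip: of_nat_mult of_nat_add)
    then have "real (block_num n) \<le> real n / real (block_len n)"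
      using block_len_pos[of n] by (simp add: field_simps)
    then have "(real (block_num n) / sqrt (real n))\<^sup>2 \<le> (real n / real (block_len n) / sqrt (real n))\<^sup>2"
      by (intro power_mono divide_right_mono) auto
    also have "\<dots> = real n / (real (block_len n))\<^sup>2"
      using elim by (simp only: power_divide real_sqrt_pow2 of_nat_0_le_iff) (simp add: power2_eq_square)
    also have "\<dots> \<le> sqrt (8 * (1 / real (block_len n)))"
    proof (rule real_le_rsqrt)
      have "(real n / (real (block_len n))\<^sup>2)\<^sup>2 = (real n)\<^sup>2 / real (block_len n) ^ 4"
        by (simp add: power_divide power_mult[symmetric])
      also have "\<dots> \<le> (8 * real (block_len n) ^ 3) / real (block_len n) ^ 4"
        using block_len_cube(2)[OF elim] by (intro divide_right_mono) auto
      also have "\<dots> = 8 * (1 / real (block_len n))"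
        using block_len_pos[of n] by (simp add: power4_eq_xxxx power3_eq_cube)
      finally show "(real n / (real (block_len n))\<^sup>2)\<^sup>2 \<le> 8 * (1 / real (block_len n))" .
    qed
    finally show ?case by (rule real_le_rsqrt)
  qed
  show "(\<lambda>n. sqrt (sqrt (8 * (1 / real (block_len n))))) \<longlonglongrightarrow> 0"
    using tendsto_real_sqrt[OF tendsto_real_sqrt[OF tendsto_mult[OF tendsto_const inverse_block_len_tendsto, of 8]]]
    by simp
qed simp

text \<open>With \<open>j = block_exp n\<close>, a remainder has length at most \<open>2 ^ j\<close>
  and variance at most \<open>K * (5/2) ^ j\<close>, whereas \<open>n\<^sup>2 \<ge> 8 ^ j\<close>.
  The squared quotient is thus at most a constant times \<open>(25/32) ^ j\<close>.\<close>

lemma (in almost_additive_process) v_remainder_tendsto: "(\<lambda>n. sqrt (v (block_rem n)) / sqrt (real n)) \<longlonglongrightarrow> 0"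
proof -
  obtain K where K: "0 \<le> K" "\<And>j m. m \<le> 2 ^ j \<Longrightarrow> v m \<le> K * (5/2) ^ j"
    using v_le_power by blast
  have "(\<lambda>n. v (block_rem n) / real n) \<longlonglongrightarrow> 0"
  proof (rule tendsto_sandwich)
    show "\<forall>\<^sub>F n in sequentially. 0 \<le> v (block_rem n) / real n" using v_nonneg by simp
    show "\<forall>\<^sub>F n in sequentially. v (block_rem n) / real n \<le> K * sqrt ((25/32) ^ block_exp n)"
      using eventually_gt_at_top[of 0]
    proof eventually_elim
      case (elim n)
      have "block_rem n \<le> 2 ^ block_exp n" using block_len_pos[of n] by (simp add: block_rem_def block_len_def less_imp_le)
      then have "v (block_rem n) \<le> K * (5/2) ^ block_exp n" by (rule K(2))
      then have "v (block_rem n) / real n \<le> K * ((5/2) ^ block_exp n / real n)"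
        using divide_right_mono[of _ _ "real n"] by fastforce
      also have "(5/2) ^ block_exp n / real n \<le> sqrt ((25/32) ^ block_exp n)"
      proof (rule real_le_rsqrt)
        have "real (8 ^ block_exp n) \<le> real (n\<^sup>2)"
          using block_exp(1)[OF elim] of_nat_le_iff by blast
        then have "((5/2) ^ block_exp n)\<^sup>2 / (real n)\<^sup>2 \<le> ((5/2) ^ block_exp n)\<^sup>2 / 8 ^ block_exp n"
          using elim by (intro divide_left_mono) auto
        also have "\<dots> = (25/32) ^ block_exp n"
        proof -
          have "((5/2 :: real) ^ block_exp n)\<^sup>2 = (25/4) ^ block_exp n"
            by (simp add: power2_eq_square flip: power_mult_distrib)
          then show ?thesis by (simp flip: power_divide)
        qed
        finally show "((5/2) ^ block_exp n / real n)\<^sup>2 \<le> (25/32) ^ block_exp n"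
          by (simp add: power_divide power_mult_distrib)
      qed
      finally show ?case using K(1) by (simp add: mult_left_mono)
    qed
    have "(\<lambda>j. (25/32 :: real) ^ j) \<longlonglongrightarrow> 0" by (intro LIMSEQ_power_zero) simp
    from filterlim_compose[OF this filterlim_block_exp]
    have "(\<lambda>n. K * sqrt ((25/32) ^ block_exp n)) \<longlonglongrightarrow> K * sqrt 0"
      by (intro tendsto_intros)
    then show "(\<lambda>n. K * sqrt ((25/32) ^ block_exp n)) \<longlonglongrightarrow> 0" by simp
  qed simp
  from tendsto_real_sqrt[OF this] show ?thesis by (simp add: real_sqrt_divide)
qed

lemma (in almost_additive_process) error_tendsto:
  "(\<lambda>n. ((real (block_num n) + 2) * d + sqrt (v (block_rem n))) / sqrt (real n)) \<longlonglongrightarrow> 0"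
proof -
  have "(\<lambda>n. 1 / sqrt (real n)) \<longlonglongrightarrow> 0"
    by (intro tendsto_divide_0[OF tendsto_const] filterlim_at_top_imp_at_infinity
        filterlim_compose[OF sqrt_at_top filterlim_real_sequentially])
  then have "(\<lambda>n. d * (real (block_num n) / sqrt (real n)) + 2 * d * (1 / sqrt (real n)) + sqrt (v (block_rem n)) / sqrt (real n)) \<longlonglongrightarrow> d * 0 + 2 * d * 0 + 0"
    by (intro tendsto_intros block_num_ratio_tendsto v_remainder_tendsto)
  then show ?thesis by (simp add: add_divide_distrib algebra_simps)
qed

text \<open>Since block lengths are powers of 2, the dyadic limit gives the convergence of
  \<open>w n\<close>, the variance of the sum of independent blocks divided by \<open>n\<close>. The
  error \<open>e n\<close> carries this limit over to all \<open>n\<close>, and it also bounds the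
  loss in the characteristic function; Levy's theorem concludes.\<close>

theorem (in almost_additive_process) central_limit:
  "\<exists>\<sigma>2\<ge>0. (\<lambda>n. variance (F 0 n) / real n) \<longlonglongrightarrow> \<sigma>2 \<and>
    weak_conv_m (\<lambda>n. distr M borel (\<lambda>x. (F 0 n x - expectation (F 0 n)) / sqrt (real n))) (centered_normal \<sigma>2)"
proof -
  obtain \<sigma>2 where \<sigma>2: "0 \<le> \<sigma>2" "(\<lambda>j. v (2 ^ j) / 2 ^ j) \<longlonglongrightarrow> \<sigma>2" using v_dyadic_limit by blast
  obtain B where B: "0 \<le> B" "\<And>j. m4 (2 ^ j) \<le> B * (2 ^ j)\<^sup>2" using m4_dyadic_le by blast
  define e where "e n = ((real (block_num n) + 2) * d + sqrt (v (block_rem n))) / sqrt (real n)" for n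
  define p where "p n = real (block_len n) / real n" for n
  define w where "w n = real (block_num n) * v (block_len n) / real n" for n
  have e: "e \<longlonglongrightarrow> 0" using error_tendsto by (simp add: e_def[abs_def])
  have p: "p \<longlonglongrightarrow> 0" using block_len_ratio_tendsto by (simp add: p_def[abs_def])
  have vL: "(\<lambda>n. v (block_len n) / real (block_len n)) \<longlonglongrightarrow> \<sigma>2"
    using filterlim_compose[OF \<sigma>2(2) filterlim_block_exp] by (simp add: block_len_def)
  have w: "w \<longlonglongrightarrow> \<sigma>2"
  proof -
    have "(\<lambda>n. (real (block_num n) * real (block_len n) / real n) * (v (block_len n) / real (block_len n))) \<longlonglongrightarrow> 1 * \<sigma>2"
      by (intro tendsto_intros blocks_ratio_tendsto vL)
    then show ?thesis using block_len_pos by (simp add: w_def[abs_def] less_imp_neq[symmetric])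
  qed
  have "(\<lambda>n. sqrt (v n / real n)) \<longlonglongrightarrow> sqrt \<sigma>2"
  proof (rule Lim_transform)
    show "(\<lambda>n. sqrt (w n)) \<longlonglongrightarrow> sqrt \<sigma>2" by (intro tendsto_intros w)
    show "(\<lambda>n. sqrt (v n / real n) - sqrt (w n)) \<longlonglongrightarrow> 0"
    proof (rule Lim_null_comparison[OF _ e])
      show "\<forall>\<^sub>F n in sequentially. norm (sqrt (v n / real n) - sqrt (w n)) \<le> e n"
      proof (rule always_eventually, rule allI)
        fix n
        have "norm (sqrt (v n / real n) - sqrt (w n)) = \<bar>sqrt (v n) - sqrt (real (block_num n) * v (block_len n))\<bar> / sqrt (real n)"
          by (simp add: w_def real_sqrt_divide flip: diff_divide_distrib)
        also have "\<dots> \<le> e n"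
          using v_blocks[of "block_num n" "block_len n" "block_rem n"] unfolding e_def blocks_plus_rem by (intro divide_right_mono) auto
        finally show "norm (sqrt (v n / real n) - sqrt (w n)) \<le> e n" .
      qed
    qed
  qed
  then have "(\<lambda>n. (sqrt (v n / real n))\<^sup>2) \<longlonglongrightarrow> (sqrt \<sigma>2)\<^sup>2" by (rule tendsto_power)
  then have var: "(\<lambda>n. v n / real n) \<longlonglongrightarrow> \<sigma>2" using v_nonneg \<sigma>2(1) by simp
  have char: "(\<lambda>n. \<phi> n (t / sqrt (real n))) \<longlonglongrightarrow> char (centered_normal \<sigma>2) t" for t
  proof (rule Lim_transform)
    let ?s = "\<lambda>n. t / sqrt (real n)"
    define a where "a n = t\<^sup>2 / 2 * w n" for n
    \<comment> \<open>The bound of \<open>\<phi>_power_approx\<close> at \<open>t / sqrt n\<close>,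
      arranged into convergent factors. Every summand contains \<open>p n\<close> or its square root
      and so vanishes in the limit.\<close>
    define b where "b n = \<bar>t\<bar> ^ 3 / 12 * (sqrt (p n) * w n + B * (sqrt (p n) * (real (block_num n) * real (block_len n) / real n)))
      + (t\<^sup>2 / 2)\<^sup>2 * (w n * (p n * (v (block_len n) / real (block_len n))))" for n
    have "(\<lambda>n. complex_of_real (exp (- a n))) \<longlonglongrightarrow> complex_of_real (exp (- (t\<^sup>2 / 2 * \<sigma>2)))"
      unfolding a_def by (intro tendsto_intros w)
    then show "(\<lambda>n. complex_of_real (exp (- a n))) \<longlonglongrightarrow> char (centered_normal \<sigma>2) t"
      using \<sigma>2(1) by (simp add: char_centered_normal exp_of_real[symmetric] mult.commute)
    have "b \<longlonglongrightarrow> \<bar>t\<bar> ^ 3 / 12 * (sqrt 0 * \<sigma>2 + B * (sqrt 0 * 1)) + (t\<^sup>2 / 2)\<^sup>2 * (\<sigma>2 * (0 * \<sigma>2))"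
      unfolding b_def[abs_def] by (intro tendsto_intros w p vL blocks_ratio_tendsto)
    then have b: "b \<longlonglongrightarrow> 0" by simp
    have eb: "(\<lambda>n. \<bar>t\<bar> * e n + b n) \<longlonglongrightarrow> 0"
      using tendsto_add[OF tendsto_mult[OF tendsto_const e] b, of "\<bar>t\<bar>"] by simp
    show "(\<lambda>n. \<phi> n (?s n) - complex_of_real (exp (- a n))) \<longlonglongrightarrow> 0"
    proof (rule Lim_null_comparison[OF _ eb])
      show "\<forall>\<^sub>F n in sequentially. norm (\<phi> n (?s n) - complex_of_real (exp (- a n))) \<le> \<bar>t\<bar> * e n + b n"
        using eventually_gt_at_top[of 0]
      proof eventually_elim
        case (elim n)
        have s2: "(?s n)\<^sup>2 = t\<^sup>2 / real n" by (simp add: power_divide)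
        have s3: "\<bar>?s n\<bar> ^ 3 = \<bar>t\<bar> ^ 3 / (real n * sqrt (real n))"
          by (simp add: power_divide power3_eq_cube)
        have 1: "cmod (\<phi> n (?s n) - \<phi> (block_len n) (?s n) ^ block_num n) \<le> \<bar>t\<bar> * e n"
          using \<phi>_blocks[of "block_num n" "block_len n" "block_rem n" "?s n"] unfolding blocks_plus_rem by (simp add: e_def)
        have ka: "real (block_num n) * ((?s n)\<^sup>2 * v (block_len n) / 2) = a n"
          by (simp add: s2 a_def w_def mult_ac)
        have 2: "cmod (\<phi> (block_len n) (?s n) ^ block_num n - complex_of_real (exp (- a n)))
            \<le> real (block_num n) * (\<bar>?s n\<bar> ^ 3 / 12 * (sqrt (block_len n) * v (block_len n) + m4 (block_len n) / sqrt (block_len n)) + ((?s n)\<^sup>2 * v (block_len n) / 2)\<^sup>2)"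
          using \<phi>_power_approx[OF block_len_pos[of n], of "?s n" "block_num n"] unfolding ka by (simp add: exp_of_real)
        have "m4 (block_len n) / sqrt (block_len n) \<le> B * (real (block_len n))\<^sup>2 / sqrt (block_len n)"
          using B(2)[of "block_exp n"] by (intro divide_right_mono) (auto simp: block_len_def)
        also have "\<dots> = B * real (block_len n) * sqrt (block_len n)"
          using block_len_pos[of n] by (simp add: power2_eq_square field_simps)
        finally have m4: "m4 (block_len n) / sqrt (block_len n) \<le> B * real (block_len n) * sqrt (block_len n)" .
        have "real (block_num n) * (\<bar>?s n\<bar> ^ 3 / 12 * (sqrt (block_len n) * v (block_len n) + m4 (block_len n) / sqrt (block_len n)) + ((?s n)\<^sup>2 * v (block_len n) / 2)\<^sup>2)
          \<le> real (block_num n) * (\<bar>?s n\<bar> ^ 3 / 12 * (sqrt (block_len n) * v (block_len n) + B * real (block_len n) * sqrt (block_len n)) + ((?s n)\<^sup>2 * v (block_len n) / 2)\<^sup>2)"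
          by (intro mult_left_mono add_mono m4 order.refl) auto
        also have "\<dots> = b n"
          unfolding s2 s3 b_def w_def p_def real_sqrt_divide using block_len_pos[of n] elim
          by (simp add: divide_simps power2_eq_square) (simp add: algebra_simps)
        finally have 3: "cmod (\<phi> (block_len n) (?s n) ^ block_num n - complex_of_real (exp (- a n))) \<le> b n"
          using 2 by linarith
        have "cmod (\<phi> n (?s n) - complex_of_real (exp (- a n))) \<le> \<bar>t\<bar> * e n + b n"
          using norm_triangle_le[OF add_mono[OF 1 3]] by simp
        then show ?case .
      qed
    qed
  qed
  have "weak_conv_m (\<lambda>n. distr M borel (\<lambda>x. (F 0 n x - expectation (F 0 n)) / sqrt (real n))) (centered_normal \<sigma>2)"
  proof (rule levy_continuity)
    show "real_distribution (distr M borel (\<lambda>x. (F 0 n x - expectation (F 0 n)) / sqrt (real n)))" for n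
      by (rule real_distribution_distr) simp
    show "real_distribution (centered_normal \<sigma>2)" by (rule real_distribution_centered_normal) fact
    show "(\<lambda>n. char (distr M borel (\<lambda>x. (F 0 n x - expectation (F 0 n)) / sqrt (real n))) t)
        \<longlonglongrightarrow> char (centered_normal \<sigma>2) t" for t
    proof -
      have "char (distr M borel (\<lambda>x. (F 0 n x - expectation (F 0 n)) / sqrt (real n))) t = \<phi> n (t / sqrt (real n))" for n
        unfolding \<phi>_def char_def by (simp add: integral_distr G_def)
      then show ?thesis using char by simp
    qed
  qed
  moreover have "variance (F 0 n) = v n" for n by (simp add: v_def G_def)
  ultimately show ?thesis using var \<sigma>2(1) by auto
qed

section \<open>Random weights on the infinite cylinder\<close>

lemma summable_cube_geometric_div2:
  fixes q :: real
  assumes "0 \<le> q" "q < 1"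
  shows "summable (\<lambda>m. 4 * (real m + 1) ^ 3 * q ^ (m div 2))"
proof -
  \<comment> \<open>The maximum keeps the root positive for \<open>q = 0\<close>. The eighth root
    bounds \<open>q ^ (m div 2)\<close> by \<open>\<tau> ^ (4 * m)\<close> up to the factor
    \<open>1 / \<tau> ^ 4\<close>, which accounts for odd \<open>m\<close>. Three of the four powers
    \<open>\<tau> ^ m\<close> absorb the cube; the fourth is summed.\<close>
  define \<tau> where "\<tau> = root 8 (max q (1/2))"
  have \<tau>: "0 < \<tau>" "\<tau> < 1" "\<tau> ^ 8 = max q (1/2)"
    using assms by (auto simp: \<tau>_def real_root_gt_zero real_root_pow_pos2)
  have "(\<lambda>m. real m * \<tau> ^ m + \<tau> ^ m) \<longlonglongrightarrow> 0 + 0"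
    using \<tau> by (intro tendsto_add powser_times_n_limit_0 LIMSEQ_power_zero) auto
  then have "Bseq (\<lambda>m. real m * \<tau> ^ m + \<tau> ^ m)"
    by (intro convergent_imp_Bseq) (auto simp: convergent_def)
  then obtain B where B: "\<bar>real m * \<tau> ^ m + \<tau> ^ m\<bar> \<le> B" for m by (auto simp: Bseq_def)
  have "summable (\<lambda>m. (4 * B ^ 3 / \<tau> ^ 4) * \<tau> ^ m)"
    using \<tau> by (intro summable_mult summable_geometric) auto
  then show ?thesis
  proof (rule summable_comparison_test')
    fix m :: nat
    have pow: "\<tau> ^ (4 * m) = (\<tau> ^ m) ^ 3 * \<tau> ^ m"
      by (simp add: power_mult mult.commute[of 4] power4_eq_xxxx power3_eq_cube mult.assoc)
    have "q ^ (m div 2) \<le> (\<tau> ^ 8) ^ (m div 2)"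
      unfolding \<tau>(3) using assms by (intro power_mono) auto
    also have "\<dots> = \<tau> ^ (8 * (m div 2))" by (simp add: power_mult)
    also have "\<dots> \<le> \<tau> ^ (4 * m) / \<tau> ^ 4"
    proof -
      have "\<tau> ^ (8 * (m div 2) + 4) \<le> \<tau> ^ (4 * m)"
        using \<tau> by (intro power_decreasing) auto
      then show ?thesis using \<tau> by (simp add: power_add field_simps)
    qed
    finally have "4 * (real m + 1) ^ 3 * q ^ (m div 2) \<le> 4 * (real m + 1) ^ 3 * (\<tau> ^ (4 * m) / \<tau> ^ 4)"
      by (intro mult_left_mono) auto
    also have "\<dots> = 4 * (real m * \<tau> ^ m + \<tau> ^ m) ^ 3 * \<tau> ^ m / \<tau> ^ 4"
    proof -
      have "real m * \<tau> ^ m + \<tau> ^ m = (real m + 1) * \<tau> ^ m" by (simp add: algebra_simps)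
      then show ?thesis by (simp add: pow power_mult_distrib)
    qed
    also have "\<dots> \<le> 4 * B ^ 3 * \<tau> ^ m / \<tau> ^ 4"
      using \<tau> B[of m] by (intro divide_right_mono mult_right_mono mult_left_mono power_mono) auto
    finally show "norm (4 * (real m + 1) ^ 3 * q ^ (m div 2)) \<le> (4 * B ^ 3 / \<tau> ^ 4) * \<tau> ^ m"
      using assms(1) by simp
  qed
qed

text \<open>Adding \<open>y N\<close> raises the fourth power by at most
  \<open>4 * (real N + 1) ^ 3 * y N\<close>, as the partial sums are at most \<open>N + 1\<close>.
  The bound is linear in \<open>y\<close>, so after taking expectations only the mean of each single
  \<open>y m\<close> enters.\<close>

lemma sum_power4_le:
  fixes y :: "nat \<Rightarrow> real"
  assumes "\<And>m. m < N \<Longrightarrow> 0 \<le> y m" "\<And>m. m < N \<Longrightarrow> y m \<le> 1"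
  shows "(\<Sum>m<N. y m) ^ 4 \<le> (\<Sum>m<N. 4 * (real m + 1) ^ 3 * y m)"
  using assms
proof (induction N)
  case (Suc N)
  define T where "T = (\<Sum>m<N. y m)"
  have T: "0 \<le> T" "T \<le> real N"
    using Suc.prems sum_bounded_above[of "{..<N}" y 1] by (auto simp: T_def intro!: sum_nonneg)
  have y: "0 \<le> y N" "y N \<le> 1" using Suc.prems by auto
  have "(T + y N) ^ 4 - T ^ 4 = y N * ((T + y N) ^ 3 + (T + y N)\<^sup>2 * T + (T + y N) * T\<^sup>2 + T ^ 3)"
    by (simp add: power4_eq_xxxx power3_eq_cube power2_eq_square algebra_simps)
  also have "\<dots> \<le> y N * ((real N + 1) ^ 3 + (real N + 1)\<^sup>2 * (real N + 1) + (real N + 1) * (real N + 1)\<^sup>2 + (real N + 1) ^ 3)"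
    using T y by (intro mult_left_mono add_mono power_mono mult_mono) auto
  also have "\<dots> = 4 * (real N + 1) ^ 3 * y N"
    by (simp add: power3_eq_cube power2_eq_square algebra_simps)
  finally have "(T + y N) ^ 4 \<le> T ^ 4 + 4 * (real N + 1) ^ 3 * y N" by simp
  also have "T ^ 4 \<le> (\<Sum>m<N. 4 * (real m + 1) ^ 3 * y m)"
    unfolding T_def using Suc.prems by (intro Suc.IH) auto
  finally show ?case by (simp add: T_def)
qed simp

text \<open>The weights of the infinite cylinder: \<open>Inl v\<close> indexes the weight of the vertex \<open>v\<close> and
  \<open>Inr e\<close> that of the edge \<open>e\<close>. Independent weights are also attached to all sets
  that are not edges; they play no role.\<close>

type_synonym 'h weights = "(nat \<times> 'h) + (nat \<times> 'h) set \<Rightarrow> real"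

definition weight_activity :: "'h weights \<Rightarrow> (nat \<times> 'h) set \<Rightarrow> real" where
  "weight_activity \<xi> = activity (\<lambda>v. \<xi> (Inl v)) (\<lambda>e. \<xi> (Inr e))"

definition shift_index :: "nat \<Rightarrow> (nat \<times> 'h) + (nat \<times> 'h) set \<Rightarrow> (nat \<times> 'h) + (nat \<times> 'h) set" where
  "shift_index a = map_sum (layer_shift a) (image (layer_shift a))"

text \<open>The empty set is a subset of every slab; its removal makes the index sets of consecutive
  slabs disjoint.\<close>

definition slab_index :: "'h set \<Rightarrow> nat \<Rightarrow> nat \<Rightarrow> ((nat \<times> 'h) + (nat \<times> 'h) set) set" where
  "slab_index VH a b = slab VH a b <+> (Pow (slab VH a b) - {{}})"

lemma weight_activity_pos: "0 < weight_activity \<xi> e"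
  by (simp add: weight_activity_def activity_def)

lemma weight_activity_shift:
  "weight_activity \<xi> (layer_shift a ` e) = weight_activity (\<lambda>i. \<xi> (shift_index a i)) e"
  by (simp add: weight_activity_def shift_index_def activity_image[OF inj_layer_shift])

lemma weight_activity_cong:
  assumes "\<And>i. i \<in> slab_index VH a b \<Longrightarrow> \<xi> i = \<eta> i" "e \<subseteq> slab VH a b" "e \<noteq> {}"
  shows "weight_activity \<xi> e = weight_activity \<eta> e"
proof -
  have "(\<Sum>v\<in>e. \<xi> (Inl v)) = (\<Sum>v\<in>e. \<eta> (Inl v))"
    using assms by (intro sum.cong) (auto simp: slab_index_def)
  moreover have "\<xi> (Inr e) = \<eta> (Inr e)"
    using assms by (intro assms(1)) (auto simp: slab_index_def)
  ultimately show ?thesis by (simp add: weight_activity_def activity_def)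
qed

lemma inj_shift_index: "inj (shift_index a)"
proof -
  have "inj (image (layer_shift a))"
    unfolding inj_def by (simp add: inj_image_eq_iff[OF inj_layer_shift])
  then show ?thesis
    unfolding shift_index_def by (rule sum.inj_map[OF inj_layer_shift])
qed

lemma disjoint_slab_index:
  fixes t :: "nat \<Rightarrow> nat"
  assumes "mono t"
  shows "disjoint_family (\<lambda>i. slab_index VH (t i) (t (i + 1)))"
proof -
  have "slab VH (t i) (t (i + 1)) \<inter> slab VH (t j) (t (j + 1)) = {}" if "i < j" for i j
  proof -
    have "t (i + 1) \<le> t j" using that by (intro monoD[OF assms]) simp
    then show ?thesis by (auto simp: slab_def)
  qed
  then have "slab VH (t i) (t (i + 1)) \<inter> slab VH (t j) (t (j + 1)) = {}" if "i \<noteq> j" for i j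
    using that by (metis Int_commute linorder_neqE_nat)
  then have "slab_index VH (t i) (t (i + 1)) \<inter> slab_index VH (t j) (t (j + 1)) = {}" if "i \<noteq> j" for i j
    using that[THEN \<open>\<And>i j. i \<noteq> j \<Longrightarrow> _\<close>] unfolding slab_index_def by fast
  then show ?thesis by (auto simp: disjoint_family_on_def)
qed

lemma slab_unpaired_weights_cong:
  assumes "\<And>i. i \<in> slab_index VH a b \<Longrightarrow> \<xi> i = \<eta> i"
  shows "slab_unpaired VH EH (weight_activity \<xi>) a b = slab_unpaired VH EH (weight_activity \<eta>) a b"
proof (rule slab_unpaired_cong)
  fix e assume "e \<in> slab_edges VH EH a b"
  moreover from this have "e \<noteq> {}" by (auto simp: slab_edges_iff)
  ultimately show "weight_activity \<xi> e = weight_activity \<eta> e"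
    using assms by (intro weight_activity_cong[of VH a b]) (auto simp: slab_edges_def)
qed

lemma block_prob_weights_cong:
  assumes "\<And>i. i \<in> slab_index VH s (s + 2) \<Longrightarrow> \<xi> i = \<eta> i"
  shows "block_prob VH (weight_activity \<xi>) (s + 1) = block_prob VH (weight_activity \<eta>) (s + 1)"
proof -
  have "weight_activity \<xi> e = weight_activity \<eta> e" if "e \<in> cut_edges VH (s + 1)" for e
    using assms that by (intro weight_activity_cong[of VH s "s + 2"]) (auto simp: cut_edges_def slab_def)
  then show ?thesis by (simp add: block_prob_def)
qed

lemma measurable_weight_activity:
  assumes "\<And>i. (\<lambda>\<xi>. X i \<xi>) \<in> borel_measurable N"
  shows "(\<lambda>\<xi>. weight_activity (\<lambda>i. X i \<xi>) e) \<in> borel_measurable N"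
  unfolding weight_activity_def activity_def using assms by measurable

text \<open>Stated for an arbitrary measurable family, because it is applied both to the coordinates
  of the infinite product and to those of a finite product filled up with 0.\<close>

lemma measurable_slab_unpaired:
  assumes "\<And>i. (\<lambda>\<xi>. X i \<xi>) \<in> borel_measurable N"
  shows "(\<lambda>\<xi>. slab_unpaired VH EH (weight_activity (\<lambda>i. X i \<xi>)) a b) \<in> borel_measurable N"
proof -
  note [measurable] = measurable_weight_activity[OF assms]
  show ?thesis unfolding slab_unpaired_def unpaired_prob_def by measurable
qed

lemma measurable_block_prob:
  assumes "\<And>i. (\<lambda>\<xi>. X i \<xi>) \<in> borel_measurable N"
  shows "(\<lambda>\<xi>. block_prob VH (weight_activity (\<lambda>i. X i \<xi>)) s) \<in> borel_measurable N"
proof -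
  note [measurable] = measurable_weight_activity[OF assms]
  show ?thesis unfolding block_prob_def by measurable
qed

section \<open>The product space of weights\<close>

locale cylinder_weights =
  fixes VH :: "'h set" and EH :: "'h set set" and L\<nu> L\<omega> :: "real measure"
  assumes finite_VH: "finite VH"
    and prob_L\<nu>: "prob_space L\<nu>" and prob_L\<omega>: "prob_space L\<omega>"
    and sets_L\<nu> [measurable_cong]: "sets L\<nu> = sets borel"
    and sets_L\<omega> [measurable_cong]: "sets L\<omega> = sets borel"
begin

definition law :: "(nat \<times> 'h) + (nat \<times> 'h) set \<Rightarrow> real measure" where
  "law = case_sum (\<lambda>_. L\<nu>) (\<lambda>_. L\<omega>)"

text \<open>Cylinders of different length may carry weights on unrelated probability spaces. A
  common infinite product turns \<open>F a b\<close>, for all \<open>a\<close> and \<open>b\<close>,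
  into one process on which the shift of layers acts.\<close>

definition P :: "'h weights measure" where
  "P = PiM UNIV law"

definition F :: "nat \<Rightarrow> nat \<Rightarrow> 'h weights \<Rightarrow> real" where
  "F a b \<xi> = slab_unpaired VH EH (weight_activity \<xi>) a b"

definition R :: "nat \<Rightarrow> 'h weights \<Rightarrow> real" where
  "R s \<xi> = block_prob VH (weight_activity \<xi>) s"

lemma sets_law [measurable_cong]: "sets (law i) = sets borel"
  by (cases i) (simp_all add: law_def sets_L\<nu> sets_L\<omega>)

lemma prob_law: "prob_space (law i)"
  by (cases i) (simp_all add: law_def prob_L\<nu> prob_L\<omega>)

lemma sets_P: "sets P = sets (PiM UNIV (\<lambda>_. borel))"
  unfolding P_def by (intro sets_PiM_cong) (simp_all add: sets_law)

lemma product_prob_space_law: "product_prob_space law"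
  by (intro product_prob_spaceI prob_law)

sublocale P: prob_space P
  unfolding P_def by (intro prob_space_PiM prob_law)

lemma measurable_component [measurable]: "(\<lambda>\<xi>. \<xi> i) \<in> borel_measurable P"
  unfolding P_def using measurable_component_singleton[of i UNIV law]
  by (simp add: measurable_cong_sets[OF refl sets_law])

lemma F_measurable [measurable]: "F a b \<in> borel_measurable P"
  unfolding F_def[abs_def] by (rule measurable_slab_unpaired) measurable

lemma R_measurable [measurable]: "R s \<in> borel_measurable P"
  unfolding R_def[abs_def] by (rule measurable_block_prob) measurable

lemma R_bounds: "0 \<le> R s \<xi>" "R s \<xi> < 1"
  unfolding R_def using block_prob_bounds[of "weight_activity \<xi>"] weight_activity_pos by blast+

lemma bounded_F: "P.bounded_rv (F a b)"
proof -
  have "\<bar>F a b \<xi>\<bar> \<le> real (b - a) * card VH" for \<xi>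
    using slab_unpaired_bounds[where x="weight_activity \<xi>" and EH=EH and a=a and b=b, OF finite_VH weight_activity_pos]
    by (simp add: F_def)
  then show ?thesis by (auto simp: P.bounded_rv_def)
qed

lemma bounded_R: "P.bounded_rv (R s)"
  using R_bounds by (auto simp: P.bounded_rv_def intro!: exI[of _ 1] less_imp_le)

text \<open>The shifted index map is injective and maps vertices to vertices and sets to sets, so
  the selected coordinates are again independent with the prescribed laws.\<close>

lemma distr_shift: "distr P P (\<lambda>\<xi> i. \<xi> (shift_index a i)) = P"
proof -
  have "law (shift_index a i) = law i" for i
    by (cases i) (simp_all add: law_def shift_index_def)
  then show ?thesis
    using distr_PiM_reindex[of UNIV law "shift_index a" UNIV, OF prob_law inj_shift_index]
    by (simp add: P_def restrict_UNIV)
qed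

lemma distr_shift_compose:
  assumes [measurable]: "f \<in> borel_measurable P"
  shows "distr P borel (\<lambda>\<xi>. f (\<lambda>i. \<xi> (shift_index a i))) = distr P borel f"
proof -
  have [measurable]: "(\<lambda>\<xi> i. \<xi> (shift_index a i)) \<in> measurable P P"
  proof -
    have "(\<lambda>\<xi>. \<lambda>i\<in>UNIV. \<xi> (shift_index a i)) \<in> measurable P (PiM UNIV law)"
      by (intro measurable_restrict) (simp add: measurable_cong_sets[OF refl sets_law])
    then show ?thesis by (simp add: P_def restrict_UNIV)
  qed
  have "distr P borel (\<lambda>\<xi>. f (\<lambda>i. \<xi> (shift_index a i))) = distr (distr P P (\<lambda>\<xi> i. \<xi> (shift_index a i))) borel f"
    by (subst distr_distr) (auto simp: comp_def)
  then show ?thesis by (simp only: distr_shift)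
qed

lemma F_stationary: "distr P borel (F a (a + n)) = distr P borel (F 0 n)"
proof -
  have "F a (a + n) = (\<lambda>\<xi>. F 0 n (\<lambda>i. \<xi> (shift_index a i)))"
    by (simp add: F_def fun_eq_iff slab_unpaired_shift weight_activity_shift)
  then show ?thesis by (simp add: distr_shift_compose)
qed

lemma expectation_R: "P.expectation (R (s + 1)) = P.expectation (R 1)"
proof -
  have "R (s + 1) = (\<lambda>\<xi>. R 1 (\<lambda>i. \<xi> (shift_index s i)))"
    using block_prob_shift[of VH _ 1 s] by (simp add: R_def fun_eq_iff weight_activity_shift add.commute)
  then have "distr P borel (R (s + 1)) = distr P borel (R 1)"
    by (simp add: distr_shift_compose)
  then have "integral\<^sup>L (distr P borel (R (s + 1))) (\<lambda>x. x) = integral\<^sup>L (distr P borel (R 1)) (\<lambda>x. x)"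
    by simp
  then show ?thesis by (simp add: integral_distr)
qed

lemma indep_components: "P.indep_vars (\<lambda>_. borel) (\<lambda>i \<xi>. \<xi> i) UNIV"
proof (subst P.indep_vars_iff_distr_eq_PiM)
  have "distr P borel (\<lambda>\<xi>. \<xi> i) = law i" for i
  proof -
    have "distr P borel (\<lambda>\<xi>. \<xi> i) = distr P (law i) (\<lambda>\<xi>. \<xi> i)"
      by (rule distr_cong) (simp_all add: sets_law)
    then show ?thesis using product_prob_space.PiM_component[OF product_prob_space_law, of i UNIV] by (simp add: P_def)
  qed
  moreover have "distr P (PiM UNIV (\<lambda>_. borel)) (\<lambda>\<xi>. \<lambda>i\<in>UNIV. \<xi> i) = distr P P (\<lambda>\<xi>. \<xi>)"
    by (rule distr_cong) (simp_all add: sets_P restrict_UNIV)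
  ultimately show "distr P (PiM UNIV (\<lambda>_. borel)) (\<lambda>\<xi>. \<lambda>i\<in>UNIV. \<xi> i) = PiM UNIV (\<lambda>i. distr P borel (\<lambda>\<xi>. \<xi> i))"
    by (simp add: distr_id2) (simp add: P_def)
qed auto

lemma indep_vars_slabs:
  assumes "mono t" and f [measurable]: "\<And>i. f i \<in> borel_measurable P"
    and local: "\<And>i \<xi> \<eta>. (\<And>x. x \<in> slab_index VH (t i) (t (i + 1)) \<Longrightarrow> \<xi> x = \<eta> x) \<Longrightarrow> f i \<xi> = (f i \<eta> :: real)"
  shows "P.indep_vars (\<lambda>_. borel) f (UNIV :: nat set)"
proof -
  \<comment> \<open>Coordinates outside \<open>K i\<close> are filled with 0; by
    \<open>local\<close> this does not change \<open>f i\<close>, which therefore factors through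
    the restriction to \<open>K i\<close>. The sets \<open>K i\<close> are disjoint.\<close>
  define K where "K i = slab_index VH (t i) (t (i + 1))" for i
  define Y where "Y i \<eta> = f i (\<lambda>x. if x \<in> K i then \<eta> x else 0)" for i \<eta>
  have 1: "P.indep_vars (\<lambda>j. PiM (K j) (\<lambda>_. borel)) (\<lambda>j \<xi>. restrict (\<lambda>i. \<xi> i) (K j)) UNIV"
    by (rule P.indep_vars_restrict[OF indep_components])
       (use disjoint_slab_index[OF assms(1)] in \<open>auto simp: K_def\<close>)
  have 2: "Y i \<in> borel_measurable (PiM (K i) (\<lambda>_. borel))" for i
  proof -
    have "(\<lambda>\<eta>. \<lambda>x\<in>UNIV. if x \<in> K i then \<eta> x else 0) \<in> measurable (PiM (K i) (\<lambda>_. borel)) (PiM UNIV law)"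
    proof (rule measurable_restrict)
      fix x
      show "(\<lambda>\<eta>. if x \<in> K i then \<eta> x else 0) \<in> measurable (PiM (K i) (\<lambda>_. borel)) (law x)"
        by (cases "x \<in> K i") (simp_all add: measurable_cong_sets[OF refl sets_law])
    qed
    then have [measurable]: "(\<lambda>\<eta> x. if x \<in> K i then \<eta> x else 0) \<in> measurable (PiM (K i) (\<lambda>_. borel)) P"
      by (simp add: P_def restrict_UNIV)
    show ?thesis unfolding Y_def by measurable
  qed
  have "P.indep_vars (\<lambda>_. borel) (\<lambda>j \<xi>. Y j (restrict (\<lambda>i. \<xi> i) (K j))) UNIV"
    by (rule P.indep_vars_compose2[OF 1]) (use 2 in auto)
  moreover have "Y j (restrict (\<lambda>i. \<xi> i) (K j)) = f j \<xi>" for j \<xi>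
    unfolding Y_def K_def by (rule local) simp
  ultimately show ?thesis by simp
qed

lemma F_indep: "mono t \<Longrightarrow> P.indep_vars (\<lambda>_. borel) (\<lambda>i. F (t i) (t (i + 1))) (UNIV :: nat set)"
  unfolding F_def[abs_def]
  by (rule indep_vars_slabs)
     (auto intro: slab_unpaired_weights_cong F_measurable[unfolded F_def[abs_def]])

section \<open>Decay in the mean and almost additivity\<close>

text \<open>The cut \<open>p + 1 + 2 * k\<close> reads the weights of the layers
  \<open>p + 2 * k + 1\<close> and \<open>p + 2 * k + 2\<close>, which form consecutive slabs of
  width 2 as \<open>k\<close> varies.\<close>

lemma R_indep: "P.indep_vars (\<lambda>_. borel) (\<lambda>k. R (p + 1 + 2 * k)) UNIV"
proof (rule indep_vars_slabs[where t="\<lambda>k. p + 2 * k"])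
  fix k and \<xi> \<eta> :: "'h weights"
  assume "\<And>x. x \<in> slab_index VH (p + 2 * k) (p + 2 * (k + 1)) \<Longrightarrow> \<xi> x = \<eta> x"
  then show "R (p + 1 + 2 * k) \<xi> = R (p + 1 + 2 * k) \<eta>"
    using block_prob_weights_cong[of VH "p + 2 * k" \<xi> \<eta>] by (simp add: R_def)
qed (auto simp: mono_def)

lemma expectation_prod_R:
  assumes "0 < p"
  shows "P.expectation (\<lambda>\<xi>. \<Prod>k<N. R (p + 2 * k) \<xi>) = P.expectation (R 1) ^ N"
proof -
  obtain p' where p: "p = p' + 1" using assms by (metis Suc_eq_plus1 gr0_conv_Suc)
  have "P.expectation (\<lambda>\<xi>. \<Prod>k<N. R (p' + 1 + 2 * k) \<xi>) = (\<Prod>k<N. P.expectation (R (p' + 1 + 2 * k)))"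
    using P.bounded_rv_integrable[OF bounded_R]
    by (intro P.indep_vars_lebesgue_integral P.indep_vars_subset[OF R_indep]) auto
  also have "\<dots> = (\<Prod>k<N. P.expectation (R 1))"
    using expectation_R[of "p' + 2 * _"] by (simp add: add_ac)
  finally show ?thesis by (simp add: p)
qed

definition q :: real where
  "q = P.expectation (R 1)"

text \<open>Activities are positive and finite, so \<open>R 1\<close> is below 1 at every point,
  possibly without any margin. The strict inequality nevertheless passes to the mean.\<close>

lemma q_bounds: "0 \<le> q" "q < 1"
proof -
  show "0 \<le> q" unfolding q_def using R_bounds by (intro integral_nonneg_AE) auto
  show "q < 1" unfolding q_def
    using P.bounded_rv_integrable[OF bounded_R] R_bounds by (intro P.expectation_less) auto
qed

lemma bounded_prod_R: "P.bounded_rv (\<lambda>\<xi>. \<Prod>k<N. R (p k) \<xi>)" for p :: "nat \<Rightarrow> nat"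
  by (induction N) (auto intro: bounded_R P.bounded_rv_mult P.bounded_rv_const)

definition S :: real where
  "S = (\<Sum>m. 4 * (real m + 1) ^ 3 * q ^ (m div 2))"

lemma expectation_sum_prod_R_power4:
  assumes "\<And>m. m < N \<Longrightarrow> 0 < p m"
  shows "P.expectation (\<lambda>\<xi>. (\<Sum>m<N. \<Prod>k<m div 2. R (p m + 2 * k) \<xi>) ^ 4) \<le> S"
proof -
  let ?Y = "\<lambda>m \<xi>. \<Prod>k<m div 2. R (p m + 2 * k) \<xi>"
  have "P.expectation (\<lambda>\<xi>. (\<Sum>m<N. ?Y m \<xi>) ^ 4) \<le> P.expectation (\<lambda>\<xi>. \<Sum>m<N. 4 * (real m + 1) ^ 3 * ?Y m \<xi>)"
  proof (rule P.expectation_mono)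
    show "(\<Sum>m<N. ?Y m \<xi>) ^ 4 \<le> (\<Sum>m<N. 4 * (real m + 1) ^ 3 * ?Y m \<xi>)" for \<xi>
      using R_bounds by (intro sum_power4_le prod_nonneg prod_le_1) (auto intro: less_imp_le)
  qed (intro P.bounded_rv_power P.bounded_rv_sum P.bounded_rv_mult P.bounded_rv_const bounded_prod_R)+
  also have "\<dots> = (\<Sum>m<N. 4 * (real m + 1) ^ 3 * q ^ (m div 2))"
  proof -
    have "P.expectation (\<lambda>\<xi>. \<Sum>m<N. 4 * (real m + 1) ^ 3 * ?Y m \<xi>)
        = (\<Sum>m<N. 4 * (real m + 1) ^ 3 * P.expectation (?Y m))"
      using P.bounded_rv_integrable[OF bounded_prod_R] by simp
    also have "\<dots> = (\<Sum>m<N. 4 * (real m + 1) ^ 3 * q ^ (m div 2))"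
      using assms by (intro sum.cong refl) (simp add: expectation_prod_R q_def)
    finally show ?thesis .
  qed
  also have "\<dots> \<le> S"
    unfolding S_def using q_bounds
    by (intro sum_le_suminf summable_cube_geometric_div2) auto
  finally show ?thesis .
qed

text \<open>The constant is \<open>8 * (S + S)\<close> times the fourth power of the layer size: 8
  from the fourth power of a sum, and one \<open>S\<close> for each side of the division.\<close>

lemma F_almost_additive:
  assumes ab: "a \<le> b" "b \<le> c"
  shows "P.expectation (\<lambda>\<xi>. (F a c \<xi> - F a b \<xi> - F b c \<xi>) ^ 4) \<le> 16 * real (card VH) ^ 4 * S"
proof -
  let ?h = "real (card VH)"
  let ?X = "\<lambda>\<xi>. \<Sum>m<b - a. \<Prod>k<m div 2. R (b - m + 2 * k) \<xi>"
  let ?Y = "\<lambda>\<xi>. \<Sum>m<c - b. \<Prod>k<m div 2. R (b + 1 + 2 * k) \<xi>"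
  have bXY: "P.bounded_rv ?X" "P.bounded_rv ?Y"
    by (auto intro!: bounded_prod_R P.bounded_rv_sum)
  have "P.expectation (\<lambda>\<xi>. (F a c \<xi> - F a b \<xi> - F b c \<xi>) ^ 4)
      \<le> P.expectation (\<lambda>\<xi>. 8 * ?h ^ 4 * (?X \<xi> ^ 4 + ?Y \<xi> ^ 4))"
  proof (rule P.expectation_mono)
    fix \<xi>
    have "\<bar>F a c \<xi> - F a b \<xi> - F b c \<xi>\<bar> \<le> ?h * (?X \<xi> + ?Y \<xi>)"
      unfolding F_def R_def by (rule slab_unpaired_almost_additive[OF finite_VH weight_activity_pos ab])
    then have "\<bar>F a c \<xi> - F a b \<xi> - F b c \<xi>\<bar> ^ 4 \<le> (?h * (?X \<xi> + ?Y \<xi>)) ^ 4"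
      by (rule power_mono) simp
    then have "(F a c \<xi> - F a b \<xi> - F b c \<xi>) ^ 4 \<le> ?h ^ 4 * (?X \<xi> + ?Y \<xi>) ^ 4"
      by (simp add: power_even_abs power_mult_distrib)
    also have "\<dots> \<le> ?h ^ 4 * (8 * (?X \<xi> ^ 4 + ?Y \<xi> ^ 4))"
      by (rule mult_left_mono[OF power4_add_le]) simp
    finally show "(F a c \<xi> - F a b \<xi> - F b c \<xi>) ^ 4 \<le> 8 * ?h ^ 4 * (?X \<xi> ^ 4 + ?Y \<xi> ^ 4)"
      by (simp only: mult_ac)
  qed (intro P.bounded_rv_power P.bounded_rv_diff P.bounded_rv_add P.bounded_rv_mult P.bounded_rv_const bounded_F bXY)+
  also have "\<dots> = 8 * ?h ^ 4 * (P.expectation (\<lambda>\<xi>. ?X \<xi> ^ 4) + P.expectation (\<lambda>\<xi>. ?Y \<xi> ^ 4))"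
    using bXY by (subst integral_mult_right_zero, subst Bochner_Integration.integral_add)
      (auto intro!: P.bounded_rv_integrable P.bounded_rv_power)
  also have "\<dots> \<le> 8 * ?h ^ 4 * (S + S)"
    by (intro mult_left_mono add_mono expectation_sum_prod_R_power4) auto
  finally show ?thesis by simp
qed

sublocale F: almost_additive_process P F "16 * real (card VH) ^ 4 * S"
  by unfold_locales (use bounded_F F_stationary F_indep F_almost_additive in auto)

text \<open>Only finitely many weights matter for a finite cylinder, so the law of the Gibbs average is
  the same for every family of independent weights with the given laws.\<close>

lemma distr_eq:
  assumes "prob_space M"
    and indep: "prob_space.indep_vars M (\<lambda>_. borel) (case_sum \<nu> \<omega>) (cyl_verts VH n <+> cyl_edges VH EH n)"
    and \<nu>: "\<And>v. v \<in> cyl_verts VH n \<Longrightarrow> distr M borel (\<nu> v) = L\<nu>"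
    and \<omega>: "\<And>e. e \<in> cyl_edges VH EH n \<Longrightarrow> distr M borel (\<omega> e) = L\<omega>"
  defines "U \<equiv> \<lambda>x. avg_unpaired VH EH n (\<lambda>v. \<nu> v x) (\<lambda>e. \<omega> e x)"
  shows "U \<in> borel_measurable M" "distr M borel U = distr P borel (F 0 n)"
proof -
  interpret M: prob_space M by fact
  define I where "I = cyl_verts VH n <+> cyl_edges VH EH n"
  define X where "X = case_sum \<nu> \<omega>"
  \<comment> \<open>Weights outside \<open>I\<close> are set to 0; the Gibbs average does not depend
    on them, so it factors through the finite family indexed by \<open>I\<close>.\<close>
  define \<Phi> where "\<Phi> \<eta> = F 0 n (\<lambda>i. if i \<in> I then \<eta> i else 0)" for \<eta>
  have "finite I"
    unfolding I_def cyl_verts_eq_slab cyl_edges_eq_slab_edges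
    by (intro finite_Plus finite_slab finite_slab_edges finite_VH)
  have rv: "X i \<in> borel_measurable M" if "i \<in> I" for i
    using indep that by (auto simp: M.indep_vars_def I_def X_def)
  have lawX: "distr M borel (X i) = law i" if "i \<in> I" for i
    using that \<nu> \<omega> by (auto simp: I_def X_def law_def)
  have F_eq: "F 0 n \<xi> = F 0 n \<eta>" if "\<And>i. i \<in> I \<Longrightarrow> \<xi> i = \<eta> i" for \<xi> \<eta>
  proof -
    have "weight_activity \<xi> e = weight_activity \<eta> e" if "e \<in> slab_edges VH EH 0 n" for e
    proof -
      have "e \<subseteq> slab VH 0 n" using that slab_edges_subset by blast
      then have "(\<Sum>v\<in>e. \<xi> (Inl v)) = (\<Sum>v\<in>e. \<eta> (Inl v))"
        by (intro sum.cong refl \<open>\<And>i. i \<in> I \<Longrightarrow> \<xi> i = \<eta> i\<close>) (auto simp: I_def cyl_verts_eq_slab)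
      moreover have "\<xi> (Inr e) = \<eta> (Inr e)"
        using that by (intro \<open>\<And>i. i \<in> I \<Longrightarrow> \<xi> i = \<eta> i\<close>) (auto simp: I_def cyl_edges_eq_slab_edges)
      ultimately show ?thesis by (simp add: weight_activity_def activity_def)
    qed
    then show ?thesis unfolding F_def by (rule slab_unpaired_cong)
  qed
  have U: "U x = \<Phi> (\<lambda>i\<in>I. X i x)" for x
  proof -
    have "U x = F 0 n (\<lambda>i. X i x)"
      by (simp add: U_def F_def X_def weight_activity_def avg_unpaired_eq[OF finite_VH])
    also have "\<dots> = \<Phi> (\<lambda>i\<in>I. X i x)" unfolding \<Phi>_def by (rule F_eq) simp
    finally show ?thesis .
  qed
  have \<Phi>P: "F 0 n \<xi> = \<Phi> (restrict \<xi> I)" for \<xi>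
    unfolding \<Phi>_def by (rule F_eq) simp
  have \<Phi> [measurable]: "\<Phi> \<in> borel_measurable (PiM I law)"
    unfolding \<Phi>_def F_def
  proof (rule measurable_slab_unpaired)
    fix i
    show "(\<lambda>\<eta>. if i \<in> I then \<eta> i else 0) \<in> borel_measurable (PiM I law)"
      using measurable_component_singleton[of i I law]
      by (cases "i \<in> I") (simp_all add: measurable_cong_sets[OF refl sets_law])
  qed
  have X [measurable]: "(\<lambda>x. \<lambda>i\<in>I. X i x) \<in> measurable M (PiM I law)"
    by (intro measurable_restrict) (simp add: measurable_cong_sets[OF refl sets_law] rv)
  have "(\<lambda>x. \<Phi> (\<lambda>i\<in>I. X i x)) \<in> borel_measurable M" by measurable
  then show "U \<in> borel_measurable M" by (simp add: U[abs_def])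
  \<comment> \<open>The index set is empty for \<open>n = 0\<close>, and the criterion that
    expresses independence by product laws is applied to a nonempty one; hence the case
    distinction.\<close>
  have "distr M (PiM I law) (\<lambda>x. \<lambda>i\<in>I. X i x) = PiM I law"
  proof (cases "I = {}")
    case True
    have "distr M (PiM {} law) (\<lambda>x. \<lambda>i\<in>{}. X i x) = distr M (count_space {\<lambda>_. undefined}) (\<lambda>_ _. undefined)"
      by (simp add: PiM_empty restrict_def)
    also have "\<dots> = return (count_space {\<lambda>_. undefined}) (\<lambda>_. undefined)"
      by (rule M.distr_const) simp
    also have "\<dots> = PiM {} law"
      unfolding PiM_empty by (rule measure_eqI) (auto simp: subset_singleton_iff)
    finally show ?thesis by (simp add: True)
  next
    case False
    have "distr M (PiM I law) (\<lambda>x. \<lambda>i\<in>I. X i x) = distr M (PiM I (\<lambda>_. borel)) (\<lambda>x. \<lambda>i\<in>I. X i x)"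
      by (intro distr_cong sets_PiM_cong) (simp_all add: sets_law)
    also have "\<dots> = PiM I (\<lambda>i. distr M borel (X i))"
      using M.indep_vars_iff_distr_eq_PiM'[where X=X and M'="\<lambda>_. borel", OF False] rv indep
      by (simp add: I_def X_def)
    also have "\<dots> = PiM I law" by (rule PiM_cong) (simp_all add: lawX)
    finally show ?thesis .
  qed
  moreover have "distr P (PiM I law) (\<lambda>\<xi>. restrict \<xi> I) = PiM I law"
    unfolding P_def by (rule product_prob_space.distr_PiM_restrict_finite[OF product_prob_space_law]) (use \<open>finite I\<close> in auto)
  moreover have "distr M borel U = distr (distr M (PiM I law) (\<lambda>x. \<lambda>i\<in>I. X i x)) borel \<Phi>"
    by (subst distr_distr) (auto simp: comp_def U[abs_def])
  moreover have "distr P borel (F 0 n) = distr (distr P (PiM I law) (\<lambda>\<xi>. restrict \<xi> I)) borel \<Phi>"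
  proof (subst distr_distr)
    show "(\<lambda>\<xi>. restrict \<xi> I) \<in> measurable P (PiM I law)"
      unfolding P_def by (rule measurable_restrict_subset) simp
  qed (auto simp: comp_def \<Phi>P[abs_def])
  ultimately show "distr M borel U = distr P borel (F 0 n)" by simp
qed

end

theorem theorem1p6:
  fixes VH :: "'h set" and EH :: "'h set set"
    and M :: "nat \<Rightarrow> 'a measure"
    and \<nu> :: "nat \<Rightarrow> nat \<times> 'h \<Rightarrow> 'a \<Rightarrow> real"
    and \<omega> :: "nat \<Rightarrow> (nat \<times> 'h) set \<Rightarrow> 'a \<Rightarrow> real"
    and L\<nu> L\<omega> :: "real measure"
    and \<epsilon> :: real
    and U :: "nat \<Rightarrow> 'a \<Rightarrow> real"
  assumes "finite_graph VH EH" and "VH \<noteq> {}"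
    and "\<And>n. prob_space (M n)"
    and "\<And>n. prob_space.indep_vars (M n) (\<lambda>_. borel) (case_sum (\<nu> n) (\<omega> n))
               (cyl_verts VH n <+> cyl_edges VH EH n)"
    and "\<And>n v. v \<in> cyl_verts VH n \<Longrightarrow> distr (M n) borel (\<nu> n v) = L\<nu>"
    and "\<And>n e. e \<in> cyl_edges VH EH n \<Longrightarrow> distr (M n) borel (\<omega> n e) = L\<omega>"
    and "\<epsilon> > 0"
    and "integrable L\<nu> (\<lambda>x. \<bar>x\<bar> powr (2 + \<epsilon>))"
    and "integrable L\<omega> (\<lambda>x. \<bar>x\<bar> powr (2 + \<epsilon>))"
  defines "U \<equiv> \<lambda>n x. avg_unpaired VH EH n (\<lambda>v. \<nu> n v x) (\<lambda>e. \<omega> n e x)"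
  shows "\<exists>\<sigma>2 \<ge> 0. (\<lambda>n. prob_space.variance (M n) (U n) / real n) \<longlonglongrightarrow> \<sigma>2 \<and>
           weak_conv_m
             (\<lambda>n. distr (M n) borel
                (\<lambda>x. (U n x - prob_space.expectation (M n) (U n)) / sqrt (real n)))
             (centered_normal \<sigma>2)"
proof -
  have fin: "finite VH" using assms(1) by (simp add: finite_graph_def)
  obtain j where j: "j \<in> VH" using assms(2) by blast
  have rv: "case_sum (\<nu> n) (\<omega> n) i \<in> borel_measurable (M n)"
    if "i \<in> cyl_verts VH n <+> cyl_edges VH EH n" for n i
    using assms(4)[of n] that by (simp add: prob_space.indep_vars_def[OF assms(3)])
  have v: "(1, j) \<in> cyl_verts VH 1"
    using j by (simp add: cyl_verts_def path_verts_def)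
  \<comment> \<open>Both laws are probability measures because some weight has them. Two layers are
    taken here, since a single layer has no edge when \<open>EH\<close> is empty.\<close>
  have e: "{(1, j), (2, j)} \<in> cyl_edges VH EH 2"
    unfolding cyl_edges_iff using j by (intro disjI1 exI[of _ 1] exI[of _ j]) auto
  have L\<nu>: "L\<nu> = distr (M 1) borel (\<nu> 1 (1, j))" and L\<omega>: "L\<omega> = distr (M 2) borel (\<omega> 2 {(1, j), (2, j)})"
    using assms(5)[OF v] assms(6)[OF e] by simp_all
  have "\<nu> 1 (1, j) \<in> borel_measurable (M 1)" "\<omega> 2 {(1, j), (2, j)} \<in> borel_measurable (M 2)"
    using rv[of "Inl (1, j)" 1] rv[of "Inr {(1, j), (2, j)}" 2] v e by auto
  then have "prob_space L\<nu>" "prob_space L\<omega>"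
    unfolding L\<nu> L\<omega> by (simp_all add: prob_space.prob_space_distr[OF assms(3)])
  moreover have "sets L\<nu> = sets borel" "sets L\<omega> = sets borel"
    unfolding L\<nu> L\<omega> by simp_all
  ultimately interpret cylinder_weights VH EH L\<nu> L\<omega>
    using fin by (intro cylinder_weights.intro)
  have [measurable]: "U n \<in> borel_measurable (M n)" and law_U: "distr (M n) borel (U n) = distr P borel (F 0 n)" for n
    unfolding U_def by (rule distr_eq[OF assms(3-6)]; assumption)+
  \<comment> \<open>Mean, variance and normalised law depend only on the law of \<open>U n\<close>,
    so all three can be computed on the product space.\<close>
  have transfer: "integral\<^sup>L (M n) (\<lambda>x. f (U n x)) = P.expectation (\<lambda>\<xi>. f (F 0 n \<xi>))"
    if [measurable]: "f \<in> borel_measurable borel" for f :: "real \<Rightarrow> real" and n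
  proof -
    have "integral\<^sup>L (M n) (\<lambda>x. f (U n x)) = integral\<^sup>L (distr (M n) borel (U n)) f"
      by (simp add: integral_distr)
    also have "\<dots> = P.expectation (\<lambda>\<xi>. f (F 0 n \<xi>))"
      unfolding law_U by (simp add: integral_distr)
    finally show ?thesis .
  qed
  have E: "integral\<^sup>L (M n) (U n) = P.expectation (F 0 n)" for n
    using transfer[of "\<lambda>x. x"] by simp
  have V: "integral\<^sup>L (M n) (\<lambda>x. (U n x - integral\<^sup>L (M n) (U n))\<^sup>2) = P.variance (F 0 n)" for n
    unfolding E using transfer[of "\<lambda>x. (x - P.expectation (F 0 n))\<^sup>2"] by simp
  have D: "distr (M n) borel (\<lambda>x. (U n x - integral\<^sup>L (M n) (U n)) / sqrt (real n))
      = distr P borel (\<lambda>\<xi>. (F 0 n \<xi> - P.expectation (F 0 n)) / sqrt (real n))" for n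
  proof -
    let ?g = "\<lambda>y. (y - P.expectation (F 0 n)) / sqrt (real n)"
    have "distr (M n) borel (\<lambda>x. (U n x - integral\<^sup>L (M n) (U n)) / sqrt (real n))
        = distr (distr (M n) borel (U n)) borel ?g"
      unfolding E by (subst distr_distr) (auto simp: comp_def)
    also have "\<dots> = distr P borel (\<lambda>\<xi>. (F 0 n \<xi> - P.expectation (F 0 n)) / sqrt (real n))"
      unfolding law_U by (subst distr_distr) (auto simp: comp_def)
    finally show ?thesis .
  qed
  show ?thesis
    unfolding V D by (rule F.central_limit)
qed

end
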